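(* Let $k\in\{1,2,\dots\}\cup\{\infty\}$, let $X_1,X_2,\dots$ be i.i.d. with density $g_0\in\mathcal D_k$ with mixing distribution function $F_0$, and let $\hat g_{n,k}$ be the maximum likelihood estimator of $g_0$ in the class $\mathcal D_k$ based on $X_1,\dots,X_n$. Then $$H(\hat g_{n,k},g_0)\to0\quad\text{almost surely as }n\to\infty .$$ Furthermore, almost surely, $\hat F_{n,k}$ converges in distribution (weakly) to $F_0$, where $\hat F_{n,k}$ is the maximum likelihood estimator of the mixing distribution function $F_0$.
   Context: For an integer $k\ge2$, a function $g$ on $(0,\infty)$ is $k$-monotone if $(-1)^l g^{(l)}$ is nonnegative, nonincreasing and convex for $l=0,\dots,k-2$; for $k=1$, if it is nonnegative and nonincreasing; for $k=\infty$ ("completely monotone"), if $(-1)^lg^{(l)}(x)\ge0$ for all $x>0$, $l\ge0$. $\mathcal D_k$ is the class of $k$-monotone probability densities on $(0,\infty)$. The MLE $\hat g_{n,k}$ maximizes $n^{-1}\sum_{i=1}^n\log g(X_i)$ over $g\in\mathcal D_k$. Every $g\in\mathcal D_k$ corresponds to a mixing distribution function $F$ on $(0,\infty)$ via $g(x)=\int_0^\infty \frac{k(t-x)_+^{k-1}}{t^k}dF(t)$ for $k<\infty$ (with $y_+=\max(y,0)$ and $(t-x)_+^0=1\{x\le t\}$ when $k=1$), and $g(x)=\int_0^\infty t^{-1}e^{-x/t}dF(t)$ for $k=\infty$; $\hat F_{n,k}$ is the mixing distribution function of $\hat g_{n,k}$. The Hellinger distance $H$ is given by $H^2(p,q)=\frac12\int(\sqrt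 p-\sqrt q)^2d\mu$ for any common dominating measure $\mu$. *)

theory Defs
  imports "HOL-Probability.Probability" "HOL-Library.Extended_Nat"
begin

text \<open>
  Functions on the positive half-line are represented by total functions on \<open>real\<close>; the values
  at nonpositive arguments are irrelevant. The derivative of order \<open>l\<close> is \<open>(deriv ^^ l) g\<close>, and
  since \<open>deriv\<close> is also defined where no derivative exists, differentiability is required
  explicitly. Only indices \<open>k \<ge> 1\<close> are meaningful.
\<close>

definition k_monotone :: "enat \<Rightarrow> (real \<Rightarrow> real) \<Rightarrow> bool" where
  "k_monotone k g \<longleftrightarrow>
     (case k of
        enat m \<Rightarrow>
          if m = 1 then
            (\<forall>x>0. 0 \<le> g x) \<and> antimono_on {0<..} g
          else
            (\<forall>l. l + 2 < m \<longrightarrow> (\<forall>x>0. (deriv ^^ l) g differentiable (at x))) \<and>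
            (\<forall>l. l + 2 \<le> m \<longrightarrow>
               (\<forall>x>0. 0 \<le> (-1) ^ l * (deriv ^^ l) g x) \<and>
               antimono_on {0<..} (\<lambda>x. (-1) ^ l * (deriv ^^ l) g x) \<and>
               convex_on {0<..} (\<lambda>x. (-1) ^ l * (deriv ^^ l) g x))
      | \<infinity> \<Rightarrow>
          (\<forall>l. \<forall>x>0. (deriv ^^ l) g differentiable (at x)) \<and>
          (\<forall>l. \<forall>x>0. 0 \<le> (-1) ^ l * (deriv ^^ l) g x))"

definition k_monotone_densities :: "enat \<Rightarrow> (real \<Rightarrow> real) set" where
  "k_monotone_densities k =
     {g. k_monotone k g \<and> set_integrable lborel {0<..} g \<and> (LINT x:{0<..}|lborel. g x) = 1}"

text \<open>
  The library logarithm satisfies \<open>ln 0 = 0\<close>, whereas a density vanishing at an observation must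
  have log-likelihood \<open>-\<infinity>\<close>; hence the values in \<open>ereal\<close>.
\<close>

definition ext_ln :: "real \<Rightarrow> ereal" where
  "ext_ln y = (if 0 < y then ereal (ln y) else - \<infinity>)"

text \<open>The first \<open>n\<close> observations are \<open>x 0, \<dots>, x (n - 1)\<close>.\<close>

definition log_likelihood :: "nat \<Rightarrow> (nat \<Rightarrow> real) \<Rightarrow> (real \<Rightarrow> real) \<Rightarrow> ereal" where
  "log_likelihood n x g = ereal (1 / real n) * (\<Sum>i<n. ext_ln (g (x i)))"

definition is_mle :: "enat \<Rightarrow> nat \<Rightarrow> (nat \<Rightarrow> real) \<Rightarrow> (real \<Rightarrow> real) \<Rightarrow> bool" where
  "is_mle k n x g \<longleftrightarrow>
     g \<in> k_monotone_densities k \<and>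
     (\<forall>h\<in>k_monotone_densities k. log_likelihood n x h \<le> log_likelihood n x g)"

text \<open>Writing the positive part as a conditional yields the convention
  \<open>(t - x)\<^sub>+\<^sup>0 = 1{x \<le> t}\<close> for \<open>k = 1\<close>.\<close>

definition mixing_kernel :: "enat \<Rightarrow> real \<Rightarrow> real \<Rightarrow> real" where
  "mixing_kernel k x t =
     (case k of
        enat m \<Rightarrow> real m * (if x \<le> t then (t - x) ^ (m - 1) else 0) / t ^ m
      | \<infinity> \<Rightarrow> exp (- x / t) / t)"

definition pos_distribution_function :: "(real \<Rightarrow> real) \<Rightarrow> bool" where
  "pos_distribution_function F \<longleftrightarrow>
     mono F \<and> (\<forall>x. continuous (at_right x) F) \<and> (\<forall>x\<le>0. F x = 0) \<and> (F \<longlongrightarrow> 1) at_top"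

text \<open>
  The mixture representation is an identity of densities, hence almost everywhere: for \<open>k = 1\<close>
  the mixture is left-continuous, while a nonincreasing density may take any intermediate value
  at its jumps. For \<open>k \<ge> 2\<close> both sides are continuous in \<open>x\<close>, so it holds at every \<open>x > 0\<close>.
\<close>

definition is_mixing_df :: "enat \<Rightarrow> (real \<Rightarrow> real) \<Rightarrow> (real \<Rightarrow> real) \<Rightarrow> bool" where
  "is_mixing_df k g F \<longleftrightarrow>
     pos_distribution_function F \<and>
     (AE x in lborel. 0 < x \<longrightarrow>
        g x = (LINT t:{0<..}|interval_measure F. mixing_kernel k x t))"

definition hellinger_dist :: "'a measure \<Rightarrow> ('a \<Rightarrow> real) \<Rightarrow> ('a \<Rightarrow> real) \<Rightarrow> real" where
  "hellinger_dist \<mu> p q = sqrt (1 / 2 * (LINT x|\<mu>. (sqrt (p x) - sqrt (q x))\<^sup>2))"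

end

theory Submission
  imports Defs
begin

text \<open>
  Every \<open>k\<close>-monotone density is nonincreasing, and the class of such densities is convex. Moving from the
  maximizer \<open>g\<close> towards the true density \<open>p\<close> does not increase the likelihood, so the empirical mean of
  \<open>p / g\<close> is at most \<open>1\<close> (\<open>mle_mean_ratio\<close>). If the empirical measure could be replaced by the true one,
  this would read \<open>\<integral> p\<^sup>2 / g \<le> 1\<close>, whereas Cauchy and Schwarz give
  \<open>1 = (\<integral> p)\<^sup>2 \<le> (\<integral> p\<^sup>2 / g) (\<integral> g) \<le> 1\<close>; equality forces \<open>g = p\<close>. Monotonicity justifies the
  replacement although \<open>g\<close> varies with the sample: on each cell of a grid the ratio \<open>p / g\<close> is
  bounded below by a ratio of values at the end points, so only the empirical frequencies of countably
  many intervals matter (\<open>grid_chi_square_le\<close>), and these converge almost surely by the inequality of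
  Hoeffding (\<open>AE_empirical_frequency\<close>). The equality case is used in quantitative form: the \<open>\<chi>\<^sup>2\<close> sum
  of the two densities over the grid is small, hence so is their \<open>L\<^sup>1\<close> distance
  (\<open>L1_le_grid_defect\<close>, \<open>L1_convergence_from_mean_ratio\<close>), and the squared Hellinger distance is at
  most half the \<open>L\<^sup>1\<close> distance.

  For the mixing distributions, a variable with density \<open>g\<close> is a product of a variable with distribution
  function \<open>F\<close> and an independent beta or exponential variable. Passing to logarithms, the characteristic
  function of the sum is the product of the characteristic functions, and the one of the logarithm
  of the beta or exponential variable has no zeros
  (\<open>mixing_kernel_integrable_mellin_nonzero\<close>). Convergence in \<open>L\<^sup>1\<close> of the densities therefore implies
  pointwise convergence of the characteristic functions of the logarithms of the mixing variables, and
  the continuity theorem of Levy gives weak convergence (\<open>weak_conv_mixing_df\<close>).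
\<close>

section \<open>Convexity of the class and the first order condition for the maximum\<close>

lemma higher_deriv_linear_combination:
  fixes f g :: "real \<Rightarrow> real"
  assumes "\<And>i x. i < l \<Longrightarrow> 0 < x \<Longrightarrow> (deriv ^^ i) f differentiable at x"
    and "\<And>i x. i < l \<Longrightarrow> 0 < x \<Longrightarrow> (deriv ^^ i) g differentiable at x"
    and "0 < x"
  shows "(deriv ^^ l) (\<lambda>x. a * f x + b * g x) x = a * (deriv ^^ l) f x + b * (deriv ^^ l) g x"
  using assms
proof (induction l arbitrary: x)
  case (Suc l)
  have "\<forall>\<^sub>F y in nhds x. y \<in> {0<..}"
    using Suc.prems(3) by (intro eventually_nhds_in_open) auto
  then have "\<forall>\<^sub>F y in nhds x. (deriv ^^ l) (\<lambda>x. a * f x + b * g x) y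
      = a * (deriv ^^ l) f y + b * (deriv ^^ l) g y"
    by eventually_elim (use Suc in auto)
  then have "(deriv ^^ Suc l) (\<lambda>x. a * f x + b * g x) x
      = deriv (\<lambda>y. a * (deriv ^^ l) f y + b * (deriv ^^ l) g y) x"
    by (simp add: deriv_cong_ev)
  also have "\<dots> = a * (deriv ^^ Suc l) f x + b * (deriv ^^ Suc l) g x"
  proof (rule DERIV_imp_deriv)
    have "DERIV ((deriv ^^ l) f) x :> deriv ((deriv ^^ l) f) x"
      using Suc.prems(1)[of l x] Suc.prems(3) by (simp add: DERIV_deriv_iff_real_differentiable)
    moreover have "DERIV ((deriv ^^ l) g) x :> deriv ((deriv ^^ l) g) x"
      using Suc.prems(2)[of l x] Suc.prems(3) by (simp add: DERIV_deriv_iff_real_differentiable)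
    ultimately show "DERIV (\<lambda>y. a * (deriv ^^ l) f y + b * (deriv ^^ l) g y) x :>
        a * (deriv ^^ Suc l) f x + b * (deriv ^^ Suc l) g x"
      by (auto intro!: derivative_eq_intros)
  qed
  finally show ?case .
qed simp

lemma higher_deriv_linear_combination_differentiable:
  fixes f g :: "real \<Rightarrow> real"
  assumes "\<And>i x. i \<le> l \<Longrightarrow> 0 < x \<Longrightarrow> (deriv ^^ i) f differentiable at x"
    and "\<And>i x. i \<le> l \<Longrightarrow> 0 < x \<Longrightarrow> (deriv ^^ i) g differentiable at x"
    and "0 < x"
  shows "(deriv ^^ l) (\<lambda>x. a * f x + b * g x) differentiable at x"
proof -
  have ev: "\<forall>\<^sub>F y in nhds x. y \<in> {0<..}"
    using assms(3) by (intro eventually_nhds_in_open) auto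
  have "\<forall>\<^sub>F y in nhds x. a * (deriv ^^ l) f y + b * (deriv ^^ l) g y
      = (deriv ^^ l) (\<lambda>x. a * f x + b * g x) y"
    using ev by eventually_elim (use higher_deriv_linear_combination[of l f g] assms in auto)
  moreover have "(\<lambda>y. a * (deriv ^^ l) f y + b * (deriv ^^ l) g y) differentiable at x"
    using assms by (intro derivative_intros) auto
  ultimately show ?thesis
    unfolding real_differentiable_def by (subst DERIV_cong_ev[OF refl _ refl, symmetric])
qed

text \<open>
  Being \<open>k\<close>-monotone is a list of signs, monotonicity and convexity conditions on derivatives, each
  of them stable under nonnegative linear combinations. The value of a higher derivative at a point
  depends on the function near that point only, so the linearity of \<open>deriv\<close> on \<open>(0,\<infinity>)\<close> suffices.
\<close>

lemma k_monotone_cone: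
  assumes f: "k_monotone k f" and g: "k_monotone k g" and "0 \<le> a" "0 \<le> b"
  shows "k_monotone k (\<lambda>x. a * f x + b * g x)"
proof (cases k)
  case infinity
  have "0 \<le> (-1) ^ l * (deriv ^^ l) (\<lambda>x. a * f x + b * g x) x" if "0 < x" for l x
  proof -
    have "(-1) ^ l * (deriv ^^ l) (\<lambda>x. a * f x + b * g x) x
        = a * ((-1) ^ l * (deriv ^^ l) f x) + b * ((-1) ^ l * (deriv ^^ l) g x)"
      using f g that infinity
      by (subst higher_deriv_linear_combination) (auto simp: k_monotone_def algebra_simps)
    then show ?thesis
      using f g that infinity assms(3,4) by (auto simp: k_monotone_def)
  qed
  then show ?thesis
    using f g infinity by (auto simp: k_monotone_def intro!: higher_deriv_linear_combination_differentiable)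
next
  case (enat m)
  show ?thesis
  proof (cases "m = 1")
    case True
    have "antimono_on {0<..} (\<lambda>x. a * f x + b * g x)"
      using f g enat True assms(3,4)
      by (auto simp: k_monotone_def monotone_on_def intro!: add_mono mult_left_mono)
    then show ?thesis
      using f g enat True assms(3,4) by (auto simp: k_monotone_def one_enat_def)
  next
    case False
    define D where "D l h x = (-1) ^ l * (deriv ^^ l) h x" for l and h :: "real \<Rightarrow> real" and x
    have fk: "\<And>l x. l + 2 < m \<Longrightarrow> 0 < x \<Longrightarrow> (deriv ^^ l) f differentiable at x"
         "\<And>l x. l + 2 \<le> m \<Longrightarrow> 0 < x \<Longrightarrow> 0 \<le> D l f x"
         "\<And>l. l + 2 \<le> m \<Longrightarrow> antimono_on {0<..} (D l f)"
         "\<And>l. l + 2 \<le> m \<Longrightarrow> convex_on {0<..} (D l f)"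
      and gk: "\<And>l x. l + 2 < m \<Longrightarrow> 0 < x \<Longrightarrow> (deriv ^^ l) g differentiable at x"
         "\<And>l x. l + 2 \<le> m \<Longrightarrow> 0 < x \<Longrightarrow> 0 \<le> D l g x"
         "\<And>l. l + 2 \<le> m \<Longrightarrow> antimono_on {0<..} (D l g)"
         "\<And>l. l + 2 \<le> m \<Longrightarrow> convex_on {0<..} (D l g)"
      using f g enat False by (auto simp: k_monotone_def D_def[abs_def])
    have D: "D l (\<lambda>x. a * f x + b * g x) x = a * D l f x + b * D l g x"
      if "l + 2 \<le> m" "0 < x" for l x
      unfolding D_def
      by (subst higher_deriv_linear_combination) (use that fk(1) gk(1) in \<open>auto simp: algebra_simps\<close>)
    have "antimono_on {0<..} (D l (\<lambda>x. a * f x + b * g x))" if "l + 2 \<le> m" for l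
      using fk(3)[OF that] gk(3)[OF that] assms(3,4) that
      by (auto simp: monotone_on_def D intro!: add_mono mult_left_mono)
    moreover have "convex_on {0<..} (D l (\<lambda>x. a * f x + b * g x))" if "l + 2 \<le> m" for l
    proof -
      have "convex_on {0<..} (\<lambda>x. a * D l f x + b * D l g x)"
        using fk(4)[OF that] gk(4)[OF that] assms(3,4)
        by (intro convex_on_add convex_on_cmul) auto
      moreover have "0 < u * x + v * y" if "0 < x" "0 < y" "0 \<le> u" "0 \<le> v" "u + v = 1" for u v x y :: real
        using convexD[of "{0<..}" x y u v] that by auto
      ultimately show ?thesis
        using that by (auto simp: convex_on_def D)
    qed
    moreover have "0 \<le> D l (\<lambda>x. a * f x + b * g x) x" if "l + 2 \<le> m" "0 < x" for l x
      using fk(2)[OF that] gk(2)[OF that] assms(3,4) that by (simp add: D)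
    moreover have "(deriv ^^ l) (\<lambda>x. a * f x + b * g x) differentiable at x"
      if "l + 2 < m" "0 < x" for l x
      using that fk(1) gk(1) by (intro higher_deriv_linear_combination_differentiable) auto
    ultimately show ?thesis
      using False enat by (auto simp: k_monotone_def D_def[abs_def])
  qed
qed

text \<open>
  Apart from the convexity of the class, the convergence of the density estimators rests on these two
  properties; this is why one proof covers every \<open>k\<close>.
\<close>

lemma k_monotone_nonneg_antimono:
  assumes g: "k_monotone k g" and "1 \<le> k"
  shows "\<And>x. 0 < x \<Longrightarrow> 0 \<le> g x" "antimono_on {0<..} g"
proof -
  have "(\<forall>x>0. 0 \<le> g x) \<and> antimono_on {0<..} g"
  proof (cases k)
    case (enat m)
    then have "m = 1 \<or> 2 \<le> m"
      using assms(2) by (cases m) (auto simp: one_enat_def)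
    then show ?thesis
      using g enat by (auto simp: k_monotone_def dest: spec[of _ 0] split: if_splits)
  next
    case infinity
    then have diff: "\<And>l x. 0 < x \<Longrightarrow> (deriv ^^ l) g differentiable at x"
      and sign: "\<And>l x. 0 < x \<Longrightarrow> 0 \<le> (-1) ^ l * (deriv ^^ l) g x"
      using g by (auto simp: k_monotone_def)
    have "g y \<le> g x" if "0 < x" "x \<le> y" for x y
    proof (rule DERIV_nonpos_imp_nonincreasing[OF that(2)])
      fix z assume "x \<le> z" "z \<le> y"
      then have "0 < z" using that by auto
      then have "DERIV g z :> deriv g z" "deriv g z \<le> 0"
        using diff[of z 0] sign[of z 1] by (auto simp: DERIV_deriv_iff_real_differentiable)
      then show "\<exists>d. DERIV g z :> d \<and> d \<le> 0" by blast
    qed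
    then show ?thesis
      using sign[of _ 0] by (auto simp: monotone_on_def)
  qed
  then show "\<And>x. 0 < x \<Longrightarrow> 0 \<le> g x" "antimono_on {0<..} g" by auto
qed

lemma k_monotone_densities_convex:
  assumes f: "f \<in> k_monotone_densities k" and g: "g \<in> k_monotone_densities k"
    and "0 \<le> t" "t \<le> 1"
  shows "(\<lambda>x. (1 - t) * f x + t * g x) \<in> k_monotone_densities k"
proof -
  have "k_monotone k (\<lambda>x. (1 - t) * f x + t * g x)"
    using assms by (intro k_monotone_cone) (auto simp: k_monotone_densities_def)
  moreover have "set_integrable lborel {0<..} (\<lambda>x. (1 - t) * f x + t * g x)"
    using f g by (intro set_integral_add set_integrable_mult_right)
      (auto simp: k_monotone_densities_def)
  moreover have "(LINT x:{0<..}|lborel. (1 - t) * f x + t * g x) = 1"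
    using f g by (subst set_integral_add) (auto simp: k_monotone_densities_def)
  ultimately show ?thesis
    by (simp add: k_monotone_densities_def)
qed

lemma ext_ln_sum_eq:
  assumes "\<And>i. i < n \<Longrightarrow> 0 < y i"
  shows "(\<Sum>i<n. ext_ln (y i)) = ereal (\<Sum>i<n. ln (y i))"
proof -
  have "(\<Sum>i<n. ext_ln (y i)) = (\<Sum>i<n. ereal (ln (y i)))"
    using assms by (intro sum.cong) (auto simp: ext_ln_def)
  then show ?thesis by simp
qed

lemma log_likelihood_eq:
  assumes "\<And>i. i < n \<Longrightarrow> 0 < g (x i)"
  shows "log_likelihood n x g = ereal ((1 / real n) * (\<Sum>i<n. ln (g (x i))))"
  unfolding log_likelihood_def using ext_ln_sum_eq[of n "\<lambda>i. g (x i)"] assms by simp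

lemma log_likelihood_eq_minus_infinity:
  assumes "i < n" "g (x i) \<le> 0"
  shows "log_likelihood n x g = - \<infinity>"
proof -
  have "(\<Sum>i<n. ext_ln (g (x i))) = ext_ln (g (x i)) + (\<Sum>i\<in>{..<n} - {i}. ext_ln (g (x i)))"
    using assms(1) by (intro sum.remove) auto
  moreover have "(\<Sum>i\<in>{..<n} - {i}. ext_ln (g (x i))) \<noteq> \<infinity>"
    by (subst sum_Pinfty) (auto simp: ext_ln_def)
  ultimately have "(\<Sum>i<n. ext_ln (g (x i))) = - \<infinity>"
    using assms(2) by (cases "\<Sum>i\<in>{..<n} - {i}. ext_ln (g (x i))") (auto simp: ext_ln_def)
  then show ?thesis
    using assms(1) by (simp add: log_likelihood_def)
qed

text \<open>
  The first order condition for the maximum. By convexity of the class the log-likelihood of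
  \<open>(1 - t) g + t g0\<close> is at most that of \<open>g\<close> for every \<open>0 < t < 1\<close>, so the derivative at \<open>t = 0\<close>, which
  is the sum of \<open>g0 / g - 1\<close> over the observations, cannot be positive. Comparing the likelihoods of
  \<open>g\<close> and \<open>g0\<close> alone would bound a mean of \<open>ln (g0 / g)\<close>, a function that is unbounded on both sides;
  here the ratio \<open>g0 / g\<close> is bounded below and may be minorized by step functions.
\<close>

lemma mle_mean_ratio:
  assumes mle: "is_mle k n x g" and g0: "g0 \<in> k_monotone_densities k"
    and pos: "\<And>i. i < n \<Longrightarrow> 0 < g0 (x i)"
  shows "\<And>i. i < n \<Longrightarrow> 0 < g (x i)" "(\<Sum>i<n. g0 (x i) / g (x i)) \<le> real n"
proof -
  have g: "g \<in> k_monotone_densities k"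
    and max: "\<And>h. h \<in> k_monotone_densities k \<Longrightarrow> log_likelihood n x h \<le> log_likelihood n x g"
    using mle by (auto simp: is_mle_def)
  have gpos: "0 < g (x i)" if "i < n" for i
  proof (rule ccontr)
    assume "\<not> 0 < g (x i)"
    then have "log_likelihood n x g = - \<infinity>"
      using that by (intro log_likelihood_eq_minus_infinity) auto
    then show False
      using max[OF g0] pos by (simp add: log_likelihood_eq)
  qed
  then show "\<And>i. i < n \<Longrightarrow> 0 < g (x i)" .
  define r where "r i = g0 (x i) / g (x i)" for i
  \<comment> \<open>\<open>\<phi> t\<close> is the gain in log-likelihood on moving from \<open>g\<close> a fraction \<open>t\<close> of the way to \<open>g0\<close>.\<close>
  define \<phi> where "\<phi> t = (\<Sum>i<n. ln (1 + t * (r i - 1)))" for t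
  have \<phi>_nonpos: "\<phi> t \<le> 0" if t: "0 < t" "t < 1" for t
  proof (cases "n = 0")
    case False
    let ?h = "\<lambda>x. (1 - t) * g x + t * g0 x"
    have hpos: "0 < ?h (x i)" if "i < n" for i
      using t gpos[OF that] pos[OF that] by (intro add_pos_pos mult_pos_pos) auto
    have "log_likelihood n x ?h \<le> log_likelihood n x g"
      using g g0 t by (intro max k_monotone_densities_convex) auto
    then have "(\<Sum>i<n. ln (?h (x i))) \<le> (\<Sum>i<n. ln (g (x i)))"
      using hpos gpos False by (simp add: log_likelihood_eq field_simps)
    moreover have "ln (?h (x i)) = ln (g (x i)) + ln (1 + t * (r i - 1))" if "i < n" for i
    proof -
      have eq: "?h (x i) = g (x i) * (1 + t * (r i - 1))"
        using gpos[OF that] by (simp add: r_def field_simps)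
      then have "0 < 1 + t * (r i - 1)"
        using hpos[OF that] gpos[OF that] by (simp add: zero_less_mult_iff)
      then show ?thesis
        unfolding eq using gpos[OF that] by (intro ln_mult_pos) auto
    qed
    ultimately show ?thesis
      by (simp add: \<phi>_def sum.distrib)
  qed (simp add: \<phi>_def)
  have "(\<phi> has_real_derivative (\<Sum>i<n. r i - 1)) (at 0)"
    unfolding \<phi>_def by (auto intro!: derivative_eq_intros)
  moreover have "\<not> (\<exists>d>0. \<forall>t>0. t < d \<longrightarrow> \<phi> 0 < \<phi> (0 + t))"
  proof
    assume "\<exists>d>0. \<forall>t>0. t < d \<longrightarrow> \<phi> 0 < \<phi> (0 + t)"
    then obtain d where "d > 0" and d: "\<And>t. 0 < t \<Longrightarrow> t < d \<Longrightarrow> 0 < \<phi> t"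
      by (auto simp: \<phi>_def)
    moreover have "0 < min d 1 / 2" "min d 1 / 2 < d" "min d 1 / 2 < 1"
      using \<open>d > 0\<close> by (auto simp: min_def)
    ultimately show False
      using d[of "min d 1 / 2"] \<phi>_nonpos[of "min d 1 / 2"] by linarith
  qed
  ultimately have "(\<Sum>i<n. r i - 1) \<le> 0"
    using DERIV_pos_inc_right[of \<phi> "\<Sum>i<n. r i - 1" 0] by force
  then show "(\<Sum>i<n. g0 (x i) / g (x i)) \<le> real n"
    by (simp add: r_def sum_subtractf)
qed

lemma monotone_density_iff:
  "g \<in> k_monotone_densities 1 \<longleftrightarrow>
     antimono_on {0<..} g \<and> set_integrable lborel {0<..} g \<and> (\<forall>x>0. 0 \<le> g x) \<and>
     (LINT x:{0<..}|lborel. g x) = 1"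
  by (auto simp: k_monotone_densities_def k_monotone_def one_enat_def)

lemma k_monotone_densities_subset_monotone:
  assumes "1 \<le> k"
  shows "k_monotone_densities k \<subseteq> k_monotone_densities 1"
  using k_monotone_nonneg_antimono[OF _ assms]
  by (auto simp: monotone_density_iff) (auto simp: k_monotone_densities_def)

section \<open>Convergence of nonincreasing densities on a grid\<close>

lemma antimono_set_integral_bounds:
  fixes f :: "real \<Rightarrow> real"
  assumes anti: "antimono_on {0<..} f" and int: "set_integrable lborel {0<..} f"
    and "0 < c" "c \<le> d"
  shows "(d - c) * f d \<le> (LINT x:{c<..d}|lborel. f x)"
    and "(LINT x:{c<..d}|lborel. f x) \<le> (d - c) * f c"
proof -
  have int': "set_integrable lborel {c<..d} f"
    by (rule set_integrable_subset[OF int]) (use assms(3) in auto)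
  have const: "set_integrable lborel {c<..d} (\<lambda>x. y)" "(LINT x:{c<..d}|lborel. y) = (d - c) * y" for y :: real
    using assms(4) by (auto simp: set_integrable_def set_lebesgue_integral_def)
  have le: "f d \<le> f x" "f x \<le> f c" if "x \<in> {c<..d}" for x
    using that assms by (auto simp: monotone_on_def)
  show "(d - c) * f d \<le> (LINT x:{c<..d}|lborel. f x)"
    using set_integral_mono[OF const(1) int', of "f d"] le(1) by (simp add: const)
  show "(LINT x:{c<..d}|lborel. f x) \<le> (d - c) * f c"
    using set_integral_mono[OF int' const(1), of "f c"] le(2) by (simp add: const)
qed

lemma set_integral_le_superset:
  fixes f :: "real \<Rightarrow> real"
  assumes "set_integrable lborel B f" "A \<in> sets lborel" "A \<subseteq> B" "\<And>x. x \<in> B \<Longrightarrow> 0 \<le> f x"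
  shows "(LINT x:A|lborel. f x) \<le> (LINT x:B|lborel. f x)"
  unfolding set_lebesgue_integral_def
  using set_integrable_subset[OF assms(1-3)] assms(1,3,4)
  by (intro integral_mono) (auto simp: set_integrable_def indicator_def)

definition grid_cell :: "real \<Rightarrow> nat \<Rightarrow> real set" where
  "grid_cell w j = {real j * w<..real (Suc j) * w}"

lemma grid_cell_disjoint:
  assumes "0 < w" "x \<in> grid_cell w i" "x \<in> grid_cell w j"
  shows "i = j"
proof -
  have "real i * w < real (Suc j) * w" "real j * w < real (Suc i) * w"
    using assms(2,3) by (auto simp: grid_cell_def)
  then have "i < Suc j" "j < Suc i"
    using assms(1) by (auto simp only: mult_less_cancel_right_pos of_nat_less_iff)
  then show ?thesis by simp
qed

lemma UN_grid_cell:
  assumes "0 < w" "a \<le> b"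
  shows "(\<Union>j\<in>{a..<b}. grid_cell w j) = {real a * w<..real b * w}"
  using assms(2)
proof (induction rule: dec_induct)
  case (step b)
  have "real a * w \<le> real b * w" "real b * w \<le> real (Suc b) * w"
    using step assms(1) by (auto intro!: mult_right_mono)
  moreover have "{a..<Suc b} = insert b {a..<b}" using step by auto
  ultimately show ?case
    using step by (auto simp: grid_cell_def)
qed simp

lemma set_integral_grid_cells:
  fixes f :: "real \<Rightarrow> real"
  assumes "0 < w" "a \<le> b" and int: "set_integrable lborel {0<..} f"
  shows "(LINT x:{real a * w<..real b * w}|lborel. f x) = (\<Sum>j=a..<b. LINT x:grid_cell w j|lborel. f x)"
proof -
  have "set_integrable lborel (grid_cell w j) f" for j
    by (rule set_integrable_subset[OF int])
      (use assms(1) in \<open>auto simp: grid_cell_def intro: le_less_trans[rotated]\<close>)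
  then have "(LINT x:(\<Union>j\<in>{a..<b}. grid_cell w j)|lborel. f x) = (\<Sum>j=a..<b. LINT x:grid_cell w j|lborel. f x)"
    using grid_cell_disjoint[OF assms(1)]
    by (intro set_integral_finite_Union) (auto simp: disjoint_family_on_def, simp add: grid_cell_def)
  then show ?thesis
    using assms by (simp add: UN_grid_cell)
qed

lemma antimono_grid_bounds:
  fixes f :: "real \<Rightarrow> real"
  assumes anti: "antimono_on {0<..} f" and int: "set_integrable lborel {0<..} f"
    and "0 < w" "0 < j"
  shows "w * f (real (Suc j) * w) \<le> (LINT x:grid_cell w j|lborel. f x)"
    and "(LINT x:grid_cell w j|lborel. f x) \<le> w * f (real j * w)"
  using antimono_set_integral_bounds[OF anti int, of "real j * w" "real (Suc j) * w"] assms(3,4)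
  by (auto simp: grid_cell_def algebra_simps)

lemma antimono_telescope:
  fixes f :: "real \<Rightarrow> real"
  assumes "a \<le> b"
  shows "(\<Sum>j=a..<b. f (real j * w)) = (\<Sum>j=a..<b. f (real (Suc j) * w)) + f (real a * w) - f (real b * w)"
  using sum_Suc_diff'[OF assms, of "\<lambda>j. f (real j * w)"] by (simp add: sum_subtractf)

text \<open>
  For two densities the \<open>L\<^sup>1\<close> distance is twice the integral of the positive part of \<open>p - q\<close>. On a
  grid cell \<open>p\<close> is at most its value at the left end and \<open>q\<close> at least its value at the right end; off
  the grid the positive part is at most \<open>p\<close>, so that mass of \<open>q\<close> off the grid causes no error term.
\<close>

lemma L1_le_grid_sum:
  fixes p q :: "real \<Rightarrow> real"
  assumes p: "antimono_on {0<..} p" "set_integrable lborel {0<..} p" "\<And>x. 0 < x \<Longrightarrow> 0 \<le> p x"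
    and q: "antimono_on {0<..} q" "set_integrable lborel {0<..} q" "\<And>x. 0 < x \<Longrightarrow> 0 \<le> q x"
    and eq: "(LINT x:{0<..}|lborel. p x) = (LINT x:{0<..}|lborel. q x)"
    and w: "0 < w" and ab: "0 < a" "a \<le> b"
  shows "(LINT x:{0<..}|lborel. \<bar>q x - p x\<bar>) \<le>
    2 * ((LINT x:{0<..}|lborel. p x) - (LINT x:{real a * w<..real b * w}|lborel. p x)
      + w * (\<Sum>j=a..<b. max 0 (p (real j * w) - q (real (Suc j) * w))))"
proof -
  define c where "c j = max 0 (p (real j * w) - q (real (Suc j) * w))" for j
  let ?in = "{real a * w<..real b * w}"
  have in_sub: "?in \<subseteq> {0<..}"
    using w ab(1) by (auto intro: le_less_trans[rotated])
  have p_in: "set_integrable lborel ?in p"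
    by (rule set_integrable_subset[OF p(2)]) (use in_sub in auto)
  have int_pq: "set_integrable lborel {0<..} (\<lambda>x. p x - q x)"
    using p(2) q(2) by (rule set_integral_diff)
  have int_abs: "set_integrable lborel {0<..} (\<lambda>x. \<bar>q x - p x\<bar>)"
    using set_integrable_abs[OF int_pq] by (simp add: abs_minus_commute)
  have cell_int: "integrable lborel (\<lambda>x. indicator (grid_cell w j) x * c j)"
    "(LINT x|lborel. indicator (grid_cell w j) x * c j) = w * c j" for j
    using w by (auto simp: grid_cell_def algebra_simps)
  define B where "B x = indicator {0<..} x * p x - indicator ?in x * p x
     + (\<Sum>j=a..<b. indicator (grid_cell w j) x * c j)" for x
  have intB: "integrable lborel B"
    unfolding B_def using p(2) p_in cell_int(1)
    by (intro Bochner_Integration.integrable_add Bochner_Integration.integrable_diff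
       Bochner_Integration.integrable_sum) (auto simp: set_integrable_def)
  have B_eq: "(LINT x|lborel. B x) = (LINT x:{0<..}|lborel. p x) - (LINT x:?in|lborel. p x) + w * (\<Sum>j=a..<b. c j)"
  proof -
    have "(LINT x|lborel. B x) = (LINT x|lborel. indicator {0<..} x * p x - indicator ?in x * p x)
        + (LINT x|lborel. (\<Sum>j=a..<b. indicator (grid_cell w j) x * c j))"
      unfolding B_def using p(2) p_in cell_int(1)
      by (intro Bochner_Integration.integral_add Bochner_Integration.integrable_diff
          Bochner_Integration.integrable_sum) (auto simp: set_integrable_def)
    also have "(LINT x|lborel. (\<Sum>j=a..<b. indicator (grid_cell w j) x * c j)) = (\<Sum>j=a..<b. w * c j)"
      using cell_int by (subst Bochner_Integration.integral_sum) (simp_all only: refl)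
    also have "(LINT x|lborel. indicator {0<..} x * p x - indicator ?in x * p x)
        = (LINT x:{0<..}|lborel. p x) - (LINT x:?in|lborel. p x)"
      using p(2) p_in unfolding set_lebesgue_integral_def set_integrable_def by simp
    finally show ?thesis by (simp add: sum_distrib_left)
  qed
  have bound: "indicator {0<..} x * (\<bar>q x - p x\<bar> + (p x - q x)) \<le> 2 * B x" for x
  proof (cases "0 < x")
    case True
    have c0: "0 \<le> (\<Sum>j=a..<b. indicator (grid_cell w j) x * c j)"
      by (intro sum_nonneg) (auto simp: c_def)
    show ?thesis
    proof (cases "x \<in> ?in")
      case False
      then show ?thesis
        using True c0 p(3)[OF True] q(3)[OF True] by (simp add: B_def abs_if)
    next
      case x_in: True
      then obtain j where j: "j \<in> {a..<b}" "x \<in> grid_cell w j"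
        using UN_grid_cell[OF w ab(2)] by blast
      have "p x \<le> p (real j * w)" "q (real (Suc j) * w) \<le> q x"
        using j ab(1) w True p(1) q(1) by (auto simp: monotone_on_def grid_cell_def)
      then have "p x - q x \<le> c j" "0 \<le> c j"
        by (auto simp: c_def)
      then have "\<bar>q x - p x\<bar> + (p x - q x) \<le> 2 * c j"
        by linarith
      also have "c j = indicator (grid_cell w j) x * c j"
        using j by simp
      also have "\<dots> \<le> (\<Sum>j=a..<b. indicator (grid_cell w j) x * c j)"
        using j by (intro member_le_sum) (auto simp: c_def)
      finally show ?thesis
        using x_in True by (simp add: B_def)
    qed
  next
    case False
    then have "x \<notin> grid_cell w j" for j
      using w by (auto simp: grid_cell_def not_less intro: order_trans)
    moreover have "x \<notin> ?in" using in_sub False by auto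
    ultimately show ?thesis
      using False by (simp add: B_def)
  qed
  have "(LINT x:{0<..}|lborel. \<bar>q x - p x\<bar>) = (LINT x:{0<..}|lborel. \<bar>q x - p x\<bar> + (p x - q x))"
    using int_abs int_pq p(2) q(2) eq by (simp add: set_integral_add set_integral_diff)
  also have "\<dots> \<le> (LINT x|lborel. 2 * B x)"
    unfolding set_lebesgue_integral_def
    using bound intB set_integral_add(1)[OF int_abs int_pq]
    by (intro integral_mono) (auto simp: set_integrable_def)
  finally show ?thesis
    by (simp add: B_eq c_def)
qed

text \<open>
  The bracket is the \<open>\<chi>\<^sup>2\<close> sum of \<open>(l - h)\<^sup>2 / h\<close>. Where \<open>l - h\<close> exceeds \<open>\<theta> h\<close> it is at most
  \<open>(l - h)\<^sup>2 / (\<theta> h)\<close>.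
\<close>

lemma positive_part_sum_le_chi_square:
  fixes l h :: "'i \<Rightarrow> real"
  assumes "\<And>j. j \<in> J \<Longrightarrow> 0 \<le> l j" "\<And>j. j \<in> J \<Longrightarrow> 0 \<le> h j"
    and "\<And>j. j \<in> J \<Longrightarrow> 0 < l j \<Longrightarrow> 0 < h j" and "0 < \<theta>"
  shows "(\<Sum>j\<in>J. max 0 (l j - h j)) \<le>
    ((\<Sum>j\<in>J. l j * l j / h j) - 2 * (\<Sum>j\<in>J. l j) + (\<Sum>j\<in>J. h j)) / \<theta> + \<theta> * (\<Sum>j\<in>J. h j)"
proof -
  have "max 0 (l j - h j) \<le> (l j * l j / h j - 2 * l j + h j) / \<theta> + \<theta> * h j" if "j \<in> J" for j
  proof (cases "0 < h j")
    case True
    have eq: "l j * l j / h j - 2 * l j + h j = (l j - h j) * (l j - h j) / h j"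
      using True by (simp add: field_simps)
    then have nn: "0 \<le> (l j * l j / h j - 2 * l j + h j) / \<theta>"
      using True assms(4) by simp
    show ?thesis
    proof (cases "l j - h j \<le> \<theta> * h j")
      case le: True
      then show ?thesis using nn assms(4) True by simp
    next
      case False
      then have "(\<theta> * h j) * (l j - h j) \<le> (l j - h j) * (l j - h j)"
        using mult_pos_pos[OF assms(4) True] by (intro mult_right_mono) linarith+
      then have "l j - h j \<le> (l j * l j / h j - 2 * l j + h j) / \<theta>"
        unfolding eq using True assms(4) by (simp add: field_simps)
      moreover have "0 \<le> \<theta> * h j" using True assms(4) by simp
      ultimately show ?thesis using nn by (intro max.boundedI) linarith+
    qed
  next
    case False
    then have "h j = 0" "l j = 0"
      using assms(1-3)[OF that] by force+
    then show ?thesis by simp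
  qed
  then have "(\<Sum>j\<in>J. max 0 (l j - h j)) \<le> (\<Sum>j\<in>J. (l j * l j / h j - 2 * l j + h j) / \<theta> + \<theta> * h j)"
    by (rule sum_mono)
  also have "\<dots> = ((\<Sum>j\<in>J. l j * l j / h j) - 2 * (\<Sum>j\<in>J. l j) + (\<Sum>j\<in>J. h j)) / \<theta> + \<theta> * (\<Sum>j\<in>J. h j)"
    by (simp add: sum.distrib sum_subtractf sum_distrib_left flip: sum_divide_distrib)
  finally show ?thesis .
qed

text \<open>
  For an observation in cell \<open>j\<close>, monotonicity makes the ratio \<open>p / q\<close> at least the value of \<open>p\<close> at the
  right end over the value of \<open>q\<close> at the left end. Summing over observations turns the bound on the mean
  ratio into a bound on a Riemann sum of \<open>p\<^sup>2 / q\<close>, since the relative frequency of the cell is at least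
  \<open>\<rho>\<close> times its \<open>p\<close>-mass. The relative form of the frequency bound is essential: \<open>q\<close> has no positive lower
  bound, so an additive error in the frequencies could be magnified arbitrarily.
\<close>

lemma grid_chi_square_le:
  fixes p q :: "real \<Rightarrow> real" and x :: "nat \<Rightarrow> real"
  assumes p: "antimono_on {0<..} p" "set_integrable lborel {0<..} p" "\<And>x. 0 < x \<Longrightarrow> 0 \<le> p x"
    and q: "antimono_on {0<..} q"
    and x: "\<And>i. i < n \<Longrightarrow> 0 < x i" "\<And>i. i < n \<Longrightarrow> 0 < q (x i)"
    and ratio: "(\<Sum>i<n. p (x i) / q (x i)) \<le> real n"
    and freq: "\<And>j. j \<in> {a..<b} \<Longrightarrow>
      \<rho> * (LINT y:grid_cell w j|lborel. p y) \<le> real (card {i. i < n \<and> x i \<in> grid_cell w j}) / real n"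
    and w: "0 < w" and a: "0 < a" and n: "0 < n" and \<rho>: "0 < \<rho>"
  shows "\<rho> * (w * (\<Sum>j=a..<b. p (real (Suc j) * w) * p (real (Suc j) * w) / q (real j * w))) \<le> 1"
    and "\<And>j. j \<in> {a..<b} \<Longrightarrow> 0 < p (real (Suc j) * w) \<Longrightarrow> 0 < q (real j * w)"
proof -
  define l where "l j = p (real (Suc j) * w)" for j
  define h where "h j = q (real j * w)" for j
  define N where "N j = {i. i < n \<and> x i \<in> grid_cell w j}" for j
  have fin: "finite (N j)" for j by (simp add: N_def)
  have l0: "0 \<le> l j" for j
    using w by (auto simp: l_def intro!: p(3))
  have h_ge: "q (x i) \<le> h j" and l_le: "l j \<le> p (x i)" if "j \<in> {a..<b}" "i \<in> N j" for i j
    using that x(1)[of i] a w p(1) q(1) by (auto simp: h_def l_def N_def grid_cell_def monotone_on_def)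
  have freq': "\<rho> * (w * l j) \<le> real (card (N j)) / real n" if "j \<in> {a..<b}" for j
  proof -
    have "\<rho> * (w * l j) \<le> \<rho> * (LINT y:grid_cell w j|lborel. p y)"
      unfolding l_def using that a w \<rho> antimono_grid_bounds(1)[OF p(1,2), of w j] by (intro mult_left_mono) auto
    then show ?thesis using freq[OF that] by (simp add: N_def)
  qed
  show h_pos: "0 < q (real j * w)" if j: "j \<in> {a..<b}" "0 < p (real (Suc j) * w)" for j
  proof -
    have "0 < real (card (N j)) / real n"
      using freq'[OF j(1)] j(2) w \<rho> by (intro less_le_trans[OF _ freq'[OF j(1)]]) (auto simp: l_def)
    then have "N j \<noteq> {}" by (auto simp: zero_less_divide_iff)
    then obtain i where "i \<in> N j" by auto
    then show ?thesis
      using h_ge[OF j(1), of i] x(2)[of i] by (auto simp: N_def h_def)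
  qed
  have "\<rho> * (w * (l j * l j / h j)) \<le> (\<Sum>i\<in>N j. p (x i) / q (x i)) / real n" if j: "j \<in> {a..<b}" for j
  proof (cases "l j = 0")
    case True
    have "0 \<le> (\<Sum>i\<in>N j. p (x i) / q (x i))"
      using x p(3) by (intro sum_nonneg) (auto simp: N_def less_imp_le)
    then show ?thesis using True by simp
  next
    case False
    then have hj: "0 < h j"
      using l0[of j] h_pos[OF j] by (auto simp: l_def h_def)
    have "\<rho> * (w * (l j * l j / h j)) = (\<rho> * (w * l j)) * (l j / h j)"
      by simp
    also have "\<dots> \<le> (real (card (N j)) / real n) * (l j / h j)"
      using freq'[OF j] l0 hj by (intro mult_right_mono) auto
    also have "\<dots> = (\<Sum>i\<in>N j. l j / h j) / real n"
      by simp
    also have "\<dots> \<le> (\<Sum>i\<in>N j. p (x i) / q (x i)) / real n"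
      using l_le[OF j] h_ge[OF j] x l0 n
      by (intro divide_right_mono sum_mono frac_le) (auto simp: N_def less_imp_le p(3))
    finally show ?thesis .
  qed
  then have "(\<Sum>j=a..<b. \<rho> * (w * (l j * l j / h j))) \<le> (\<Sum>j=a..<b. (\<Sum>i\<in>N j. p (x i) / q (x i)) / real n)"
    by (rule sum_mono)
  also have "\<dots> = (\<Sum>j=a..<b. (\<Sum>i\<in>N j. p (x i) / q (x i))) / real n"
    by (simp flip: sum_divide_distrib)
  also have "(\<Sum>j=a..<b. (\<Sum>i\<in>N j. p (x i) / q (x i))) = (\<Sum>i\<in>(\<Union>j\<in>{a..<b}. N j). p (x i) / q (x i))"
    using fin grid_cell_disjoint[OF w] by (subst sum.UNION_disjoint) (auto simp: N_def)
  also have "\<dots> \<le> (\<Sum>i<n. p (x i) / q (x i))"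
    using x p(3) by (intro sum_mono2) (auto simp: N_def less_imp_le)
  also have "\<dots> / real n \<le> 1"
    using ratio n by simp
  finally show "\<rho> * (w * (\<Sum>j=a..<b. p (real (Suc j) * w) * p (real (Suc j) * w) / q (real j * w))) \<le> 1"
    using n by (simp add: l_def h_def sum_distrib_left divide_right_mono)
qed


text \<open>
  The grid has mesh \<open>w = 1 / a\<^sup>2\<close> and runs from \<open>a w = 1 / a\<close> to \<open>a\<^sup>3 w = a\<close>. A nonincreasing
  density is at most \<open>1 / x\<close> at \<open>x\<close>, so all errors from shifting a Riemann sum by one cell are at most
  \<open>w a = 1 / a\<close>. With \<open>l\<close> and \<open>h\<close> the values of \<open>p\<close> and \<open>q\<close> at opposite ends of the cells, the Riemann
  sums of \<open>l\<^sup>2 / h\<close>, \<open>l\<close> and \<open>h\<close> are at most \<open>1 + 2 / a\<close>, at least \<open>1 - \<tau> - 1 / a\<close> and at most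
  \<open>1 + 1 / a\<close>, respectively. Hence the \<open>\<chi>\<^sup>2\<close> sum is at most \<open>2 \<tau> + 5 / a\<close>: the equality case of
  Cauchy and Schwarz in quantitative form.
\<close>

lemma L1_le_grid_defect:
  fixes p q :: "real \<Rightarrow> real" and x :: "nat \<Rightarrow> real" and a :: nat
  assumes p_density: "p \<in> k_monotone_densities 1" and q_density: "q \<in> k_monotone_densities 1"
    and x: "\<And>i. i < n \<Longrightarrow> 0 < x i" "\<And>i. i < n \<Longrightarrow> 0 < q (x i)"
    and ratio: "(\<Sum>i<n. p (x i) / q (x i)) \<le> real n"
    and n: "0 < n" and a: "2 \<le> a" and \<theta>: "0 < \<theta>" and w_eq: "w = 1 / real a ^ 2"
    and freq: "\<And>j. j \<in> {a..<a ^ 3} \<Longrightarrow>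
      (1 - 1 / real a) * (LINT y:grid_cell w j|lborel. p y) \<le> real (card {i. i < n \<and> x i \<in> grid_cell w j}) / real n"
    and \<tau>_eq: "\<tau> = 1 - (LINT x:{1 / real a<..real a}|lborel. p x)"
  shows "(LINT x:{0<..}|lborel. \<bar>q x - p x\<bar>) \<le>
    2 * (\<tau> + 2 / real a + (2 * \<tau> + 5 / real a) / \<theta> + 2 * \<theta>)"
proof -
  have p: "antimono_on {0<..} p" "set_integrable lborel {0<..} p" "\<And>x. 0 < x \<Longrightarrow> 0 \<le> p x"
      "(LINT x:{0<..}|lborel. p x) = 1"
    and q: "antimono_on {0<..} q" "set_integrable lborel {0<..} q" "\<And>x. 0 < x \<Longrightarrow> 0 \<le> q x"
      "(LINT x:{0<..}|lborel. q x) = 1"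
    using p_density q_density by (auto simp: monotone_density_iff)
  define b where "b = a ^ 3"
  have a0: "0 < real a" "0 < a" using a by auto
  have w: "0 < w" using a0 by (simp add: w_eq)
  have ab: "a \<le> b" using a by (simp add: b_def self_le_power)
  have wa: "real a * w = 1 / real a" and wb: "real b * w = real a"
    using a0 by (simp_all add: w_eq b_def field_simps power2_eq_square power3_eq_cube)
  have inside: "{real a * w<..real b * w} = {1 / real a<..real a}"
    by (simp add: wa wb)
  define \<rho> where "\<rho> = 1 - 1 / real a"
  have \<rho>: "0 < \<rho>" using a by (simp add: \<rho>_def)
  define P where "P j = p (real j * w)" for j
  define Q where "Q j = q (real j * w)" for j
  define l where "l j = P (Suc j)" for j
  have tele: "(\<Sum>j=a..<b. P j) = (\<Sum>j=a..<b. P (Suc j)) + P a - P b"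
             "(\<Sum>j=a..<b. Q j) = (\<Sum>j=a..<b. Q (Suc j)) + Q a - Q b"
    unfolding P_def Q_def using antimono_telescope[OF ab] by auto
  have nn: "0 \<le> P j" "0 \<le> Q j" if "0 < j" for j
    unfolding P_def Q_def using p(3) q(3) w that by auto
  have mono: "P (Suc j) \<le> P j" "Q (Suc j) \<le> Q j" if "0 < j" for j
    using that w p(1) q(1) by (auto simp: P_def Q_def monotone_on_def)
  \<comment> \<open>\<open>f y \<le> 1 / y\<close> at \<open>y = a w = 1 / a\<close>\<close>
  have edge: "w * f (real a * w) \<le> 1 / real a"
    if f: "antimono_on {0<..} f" "set_integrable lborel {0<..} f" "\<And>x. 0 < x \<Longrightarrow> 0 \<le> f x"
      "(LINT x:{0<..}|lborel. f x) = 1" for f :: "real \<Rightarrow> real"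
  proof -
    have anti_a: "f (real a * w) \<le> f x" if "x \<in> {0<..real a * w}" for x
      using that f(1) w a0 by (auto simp: monotone_on_def)
    have sub: "set_integrable lborel {0<..real a * w} f"
      by (rule set_integrable_subset[OF f(2)]) auto
    have const: "set_integrable lborel {0<..real a * w} (\<lambda>_. y)" "(LINT x:{0<..real a * w}|lborel. y) = real a * w * y" for y :: real
      using w a0 by (auto simp: set_integrable_def set_lebesgue_integral_def)
    have "real a * w * f (real a * w) \<le> (LINT x:{0<..real a * w}|lborel. f x)"
      using set_integral_mono[OF const(1) sub anti_a] by (simp add: const)
    also have "\<dots> \<le> (LINT x:{0<..}|lborel. f x)"
      by (rule set_integral_le_superset[OF f(2)]) (use f(3) in auto)
    finally show ?thesis
      using a0 f(4) by (simp add: field_simps)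
  qed
  have wPa: "w * P a \<le> 1 / real a" and wQa: "w * Q a \<le> 1 / real a"
    unfolding P_def Q_def using edge[OF p] edge[OF q] by auto
  have "1 - \<tau> = (\<Sum>j=a..<b. LINT x:grid_cell w j|lborel. p x)"
    unfolding set_integral_grid_cells[OF w ab p(2), symmetric] inside \<tau>_eq by simp
  also have "\<dots> \<le> (\<Sum>j=a..<b. w * P j)"
    unfolding P_def using antimono_grid_bounds(2)[OF p(1,2) w] a0 by (intro sum_mono) auto
  also have "\<dots> = w * (\<Sum>j=a..<b. l j) + w * P a - w * P b"
    by (simp add: tele l_def flip: sum_distrib_left) (simp add: algebra_simps)
  also have "\<dots> \<le> w * (\<Sum>j=a..<b. l j) + 1 / real a"
    using wPa mult_nonneg_nonneg[OF less_imp_le[OF w] nn(1)[of b]] ab a0 by simp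
  finally have sum_l: "1 - \<tau> - 1 / real a \<le> w * (\<Sum>j=a..<b. l j)" by simp
  have "(\<Sum>j=a..<b. w * Q (Suc j)) \<le> (\<Sum>j=a..<b. LINT x:grid_cell w j|lborel. q x)"
    unfolding Q_def using antimono_grid_bounds(1)[OF q(1,2) w] a0 by (intro sum_mono) auto
  also have "\<dots> = (LINT x:{1 / real a<..real a}|lborel. q x)"
    unfolding set_integral_grid_cells[OF w ab q(2), symmetric] inside ..
  also have "\<dots> \<le> (LINT x:{0<..}|lborel. q x)"
    by (rule set_integral_le_superset[OF q(2)]) (use q(3) a0 in \<open>auto intro: less_trans[rotated]\<close>)
  finally have "w * (\<Sum>j=a..<b. Q (Suc j)) \<le> 1"
    by (simp add: q(4) sum_distrib_left)
  moreover have "w * (\<Sum>j=a..<b. Q j) = w * (\<Sum>j=a..<b. Q (Suc j)) + w * Q a - w * Q b"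
    by (simp add: tele algebra_simps)
  moreover have "0 \<le> w * Q b" using nn(2)[of b] w ab a0 by simp
  ultimately have sum_Q: "w * (\<Sum>j=a..<b. Q j) \<le> 1 + 1 / real a"
    using wQa by linarith
  note chi = grid_chi_square_le[OF p(1-3) q(1) x ratio, where a = a and b = b and \<rho> = \<rho> and w = w]
  have chi1: "\<rho> * (w * (\<Sum>j=a..<b. l j * l j / Q j)) \<le> 1"
    unfolding l_def P_def Q_def using chi(1) freq w a0 n \<rho> by (simp add: b_def \<rho>_def)
  have hpos: "0 < Q j" if "j \<in> {a..<b}" "0 < l j" for j
    using chi(2)[of j] that freq w a0 n \<rho> unfolding l_def P_def Q_def by (simp add: b_def \<rho>_def)
  have "w * (\<Sum>j=a..<b. l j * l j / Q j) \<le> 1 / \<rho>"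
    using chi1 \<rho> by (simp add: field_simps)
  also have "1 / \<rho> \<le> 1 + 2 / real a"
    using a by (simp add: \<rho>_def field_simps)
  finally have chi2: "w * (\<Sum>j=a..<b. l j * l j / Q j) \<le> 1 + 2 / real a" .
  define S where "S = (\<Sum>j=a..<b. max 0 (l j - Q j))"
  have "S \<le> ((\<Sum>j=a..<b. l j * l j / Q j) - 2 * (\<Sum>j=a..<b. l j) + (\<Sum>j=a..<b. Q j)) / \<theta> + \<theta> * (\<Sum>j=a..<b. Q j)"
    unfolding S_def by (rule positive_part_sum_le_chi_square) (use nn a0 hpos \<theta> in \<open>auto simp: l_def\<close>)
  then have "w * S \<le> w * (((\<Sum>j=a..<b. l j * l j / Q j) - 2 * (\<Sum>j=a..<b. l j) + (\<Sum>j=a..<b. Q j)) / \<theta> + \<theta> * (\<Sum>j=a..<b. Q j))"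
    using w by (intro mult_left_mono) auto
  also have "\<dots> = (w * (\<Sum>j=a..<b. l j * l j / Q j) - 2 * (w * (\<Sum>j=a..<b. l j)) + w * (\<Sum>j=a..<b. Q j)) / \<theta>
      + \<theta> * (w * (\<Sum>j=a..<b. Q j))"
    by (simp add: algebra_simps add_divide_distrib diff_divide_distrib)
  also have "\<dots> \<le> (2 * \<tau> + 5 / real a) / \<theta> + \<theta> * 2"
  proof (rule add_mono[OF divide_right_mono mult_left_mono])
    show "w * (\<Sum>j=a..<b. l j * l j / Q j) - 2 * (w * (\<Sum>j=a..<b. l j)) + w * (\<Sum>j=a..<b. Q j) \<le> 2 * \<tau> + 5 / real a"
      using chi2 sum_l sum_Q by linarith
    have "1 / real a \<le> 1" using a by simp
    then show "w * (\<Sum>j=a..<b. Q j) \<le> 2" using sum_Q by linarith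
  qed (use \<theta> in auto)
  finally have wS: "w * S \<le> (2 * \<tau> + 5 / real a) / \<theta> + 2 * \<theta>" by simp
  have "(\<Sum>j=a..<b. max 0 (P j - Q (Suc j))) \<le> (\<Sum>j=a..<b. (P j - P (Suc j)) + (Q j - Q (Suc j)) + max 0 (l j - Q j))"
    using mono a0 by (intro sum_mono) (auto simp: l_def max_def not_le)
  also have "\<dots> = P a - P b + (Q a - Q b) + S"
    by (simp add: sum.distrib sum_subtractf tele S_def)
  also have "\<dots> \<le> P a + Q a + S"
    using nn[of b] ab a0 by simp
  finally have "w * (\<Sum>j=a..<b. max 0 (P j - Q (Suc j))) \<le> w * (P a + Q a + S)"
    using w by (intro mult_left_mono) auto
  also have "\<dots> \<le> 2 / real a + ((2 * \<tau> + 5 / real a) / \<theta> + 2 * \<theta>)"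
    using wPa wQa wS by (simp add: distrib_left)
  finally have "w * (\<Sum>j=a..<b. max 0 (P j - Q (Suc j))) \<le> 2 / real a + (2 * \<tau> + 5 / real a) / \<theta> + 2 * \<theta>"
    by simp
  note main = this
  have "(LINT x:{0<..}|lborel. \<bar>q x - p x\<bar>) \<le>
      2 * (\<tau> + w * (\<Sum>j=a..<b. max 0 (P j - Q (Suc j))))"
    using L1_le_grid_sum[OF p(1-3) q(1-3) _ w a0(2) ab] unfolding inside P_def Q_def \<tau>_eq p(4) q(4) by auto
  also have "\<dots> \<le> 2 * (\<tau> + (2 / real a + (2 * \<tau> + 5 / real a) / \<theta> + 2 * \<theta>))"
    by (intro mult_left_mono add_left_mono main) simp
  finally show ?thesis by (simp only: add.assoc)
qed

text \<open>
  A fixed \<open>a\<close> involves finitely many cells. For a cell of mass \<open>m > 0\<close> the frequency exceeds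
  \<open>(1 - 1 / a) m\<close> from some \<open>n\<close> on because its limit \<open>m\<close> does, and for \<open>m = 0\<close> the bound is trivial; so
  \<open>L1_le_grid_defect\<close> applies for all large \<open>n\<close>. Both \<open>\<tau>\<close> and \<open>1 / a\<close> vanish as \<open>a\<close> grows.
\<close>

lemma L1_convergence_from_mean_ratio:
  fixes p :: "real \<Rightarrow> real" and q :: "nat \<Rightarrow> real \<Rightarrow> real" and x :: "nat \<Rightarrow> real"
  assumes p_density: "p \<in> k_monotone_densities 1"
    and q_density: "\<And>n. 1 \<le> n \<Longrightarrow> q n \<in> k_monotone_densities 1"
    and x: "\<And>i. 0 < x i" "\<And>n i. i < n \<Longrightarrow> 0 < q n (x i)"
    and ratio: "\<And>n. 1 \<le> n \<Longrightarrow> (\<Sum>i<n. p (x i) / q n (x i)) \<le> real n"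
    and freq: "\<And>a j. 0 < a \<Longrightarrow> (\<lambda>n. real (card {i. i < n \<and> x i \<in> grid_cell (1 / real a ^ 2) j}) / real n)
      \<longlonglongrightarrow> (LINT y:{0<..} \<inter> grid_cell (1 / real a ^ 2) j|lborel. p y)"
  shows "(\<lambda>n. LINT y:{0<..}|lborel. \<bar>q n y - p y\<bar>) \<longlonglongrightarrow> 0"
proof -
  have p: "set_integrable lborel {0<..} p" "(LINT x:{0<..}|lborel. p x) = 1"
    using p_density by (auto simp: monotone_density_iff)
  define D where "D n = (LINT y:{0<..}|lborel. \<bar>q n y - p y\<bar>)" for n
  define \<tau> where "\<tau> a = 1 - (LINT x:{1 / real a<..real a}|lborel. p x)" for a
  have D0: "0 \<le> D n" for n
    unfolding D_def set_lebesgue_integral_def by (intro integral_nonneg_AE) auto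
  have step: "\<forall>\<^sub>F n in sequentially. D n \<le> 2 * (\<tau> a + 2 / real a + (2 * \<tau> a + 5 / real a) / \<theta> + 2 * \<theta>)"
    if a: "2 \<le> a" and \<theta>: "0 < \<theta>" for a \<theta>
  proof -
    define w where "w = 1 / real a ^ 2"
    define m where "m j = (LINT y:grid_cell w j|lborel. p y)" for j
    have w: "0 < w" using a by (simp add: w_def)
    have "\<forall>\<^sub>F n in sequentially. (1 - 1 / real a) * m j \<le> real (card {i. i < n \<and> x i \<in> grid_cell w j}) / real n" for j
    proof (cases "m j \<le> 0")
      case True
      then have "(1 - 1 / real a) * m j \<le> 0"
        using a by (intro mult_nonneg_nonpos) auto
      then show ?thesis
        by (intro always_eventually allI) (rule order_trans, auto)
    next
      case False
      have "{0<..} \<inter> grid_cell w j = grid_cell w j"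
        using w by (auto simp: grid_cell_def intro: le_less_trans[rotated])
      then have "(\<lambda>n. real (card {i. i < n \<and> x i \<in> grid_cell w j}) / real n) \<longlonglongrightarrow> m j"
        using freq[of a j] a by (simp add: w_def m_def)
      moreover have "(1 - 1 / real a) * m j < m j"
        using False a by (simp add: algebra_simps)
      ultimately have "\<forall>\<^sub>F n in sequentially. (1 - 1 / real a) * m j < real (card {i. i < n \<and> x i \<in> grid_cell w j}) / real n"
        by (rule order_tendstoD)
      then show ?thesis by eventually_elim simp
    qed
    then have "\<forall>\<^sub>F n in sequentially. \<forall>j\<in>{a..<a ^ 3}.
        (1 - 1 / real a) * m j \<le> real (card {i. i < n \<and> x i \<in> grid_cell w j}) / real n"
      by (intro eventually_ball_finite) auto
    then show ?thesis
      using eventually_ge_at_top[of 1]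
    proof eventually_elim
      case (elim n)
      show ?case
        unfolding D_def
        by (rule L1_le_grid_defect[OF p_density q_density[OF elim(2)] x(1) x(2) ratio[OF elim(2)] _ a \<theta> w_def])
          (use elim in \<open>auto simp: m_def \<tau>_def\<close>)
    qed
  qed
  have "(\<lambda>a. LINT x:{1 / real a<..real a}|lborel. p x) \<longlonglongrightarrow> (LINT x:{0<..}|lborel. p x)"
    unfolding set_lebesgue_integral_def
  proof (rule integral_dominated_convergence)
    show "integrable lborel (\<lambda>x. norm (indicator {0<..} x *\<^sub>R p x))"
      using p(1) by (simp add: set_integrable_def)
    show "(\<lambda>x. indicator {0<..} x *\<^sub>R p x) \<in> borel_measurable lborel"
      using p(1) by (simp add: set_integrable_def)
    show "(\<lambda>x. indicator {1 / real a<..real a} x *\<^sub>R p x) \<in> borel_measurable lborel" for a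
    proof -
      have "set_integrable lborel {1 / real a<..real a} p"
        by (rule set_integrable_subset[OF p(1)]) (auto intro: le_less_trans[rotated])
      then show ?thesis by (simp add: set_integrable_def)
    qed
    show "AE x in lborel. norm (indicator {1 / real a<..real a} x *\<^sub>R p x) \<le> norm (indicator {0<..} x *\<^sub>R p x)" for a
    proof -
      have "1 / real a < y \<Longrightarrow> 0 < y" for y by (rule le_less_trans[rotated]) auto
      then show ?thesis by (auto simp: indicator_def)
    qed
    show "AE x in lborel. (\<lambda>a. indicator {1 / real a<..real a} x *\<^sub>R p x) \<longlonglongrightarrow> indicator {0<..} x *\<^sub>R p x"
    proof (intro AE_I2)
      fix x :: real
      show "(\<lambda>a. indicator {1 / real a<..real a} x *\<^sub>R p x) \<longlonglongrightarrow> indicator {0<..} x *\<^sub>R p x"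
      proof (cases "0 < x")
        case True
        have "\<forall>\<^sub>F a in sequentially. 1 / real a < x"
          by (rule order_tendstoD[OF lim_1_over_n]) (use True in auto)
        moreover have "\<forall>\<^sub>F a in sequentially. x \<le> real a"
          using filterlim_real_sequentially by (simp add: filterlim_at_top)
        ultimately have "\<forall>\<^sub>F a in sequentially. indicator {1 / real a<..real a} x *\<^sub>R p x = indicator {0<..} x *\<^sub>R p x"
          by eventually_elim (use True in auto)
        then show ?thesis by (rule tendsto_eventually)
      next
        case False
        then have "\<not> 1 / real a < x" for a
          by (metis divide_nonneg_nonneg le_less_trans of_nat_0_le_iff zero_le_one)
        then show ?thesis using False by simp
      qed
    qed
  qed
  then have \<tau>: "\<tau> \<longlonglongrightarrow> 0"
    using tendsto_diff[OF tendsto_const[of 1]] p(2) by (fastforce simp: \<tau>_def[abs_def])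
  show ?thesis
    unfolding D_def[symmetric]
  proof (rule LIMSEQ_I)
    fix r :: real assume r: "0 < r"
    \<comment> \<open>The part \<open>4 \<theta>\<close> of the bound does not vanish as \<open>a\<close> grows, so \<open>\<theta>\<close> is fixed first, with \<open>4 \<theta> < r\<close>.\<close>
    define \<theta> where "\<theta> = r / 8"
    have \<theta>: "0 < \<theta>" using r by (simp add: \<theta>_def)
    have "(\<lambda>a. 2 * (\<tau> a + 2 * (1 / real a) + (2 * \<tau> a + 5 * (1 / real a)) / \<theta> + 2 * \<theta>))
        \<longlonglongrightarrow> 2 * (0 + 2 * 0 + (2 * 0 + 5 * 0) / \<theta> + 2 * \<theta>)"
      using \<theta> by (intro tendsto_intros \<tau> lim_1_over_n) auto
    moreover have "2 * (0 + 2 * 0 + (2 * 0 + 5 * 0) / \<theta> + 2 * \<theta>) < r"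
      using r by (simp add: \<theta>_def)
    ultimately have "\<forall>\<^sub>F a in sequentially. 2 * (\<tau> a + 2 * (1 / real a) + (2 * \<tau> a + 5 * (1 / real a)) / \<theta> + 2 * \<theta>) < r"
      by (rule order_tendstoD)
    then have "\<forall>\<^sub>F a in sequentially. 2 \<le> a \<and> 2 * (\<tau> a + 2 / real a + (2 * \<tau> a + 5 / real a) / \<theta> + 2 * \<theta>) < r"
      using eventually_ge_at_top[of 2] by eventually_elim simp
    then obtain a where a: "2 \<le> a" "2 * (\<tau> a + 2 / real a + (2 * \<tau> a + 5 / real a) / \<theta> + 2 * \<theta>) < r"
      using eventually_happens'[OF sequentially_bot] by blast
    have "\<forall>\<^sub>F n in sequentially. D n < r"
      using step[OF a(1) \<theta>] by eventually_elim (use a(2) in linarith)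
    then show "\<exists>no. \<forall>n\<ge>no. norm (D n - 0) < r"
      using D0 by (auto simp: eventually_sequentially)
  qed
qed

section \<open>Empirical frequencies\<close>

text \<open>
  The strong law of large numbers for indicators: the tail bounds of Hoeffding are geometric in the
  sample size and hence summable, and the lemma of Borel and Cantelli applies.
\<close>

lemma (in prob_space) AE_empirical_frequency:
  fixes X :: "nat \<Rightarrow> 'a \<Rightarrow> real"
  assumes indep: "indep_vars (\<lambda>_. borel) X UNIV"
    and A[measurable]: "A \<in> sets borel"
    and prob_A: "\<And>i. prob (X i -` A \<inter> space M) = c"
  shows "AE \<omega> in M. (\<lambda>n. real (card {i. i < n \<and> X i \<omega> \<in> A}) / real n) \<longlonglongrightarrow> c"
proof -
  have X[measurable]: "X i \<in> borel_measurable M" for i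
    using indep by (auto simp: indep_vars_def)
  define Y where "Y i \<omega> = (indicator A (X i \<omega>) :: real)" for i \<omega>
  have Y[measurable]: "Y i \<in> borel_measurable M" for i
    unfolding Y_def by measurable
  have indep_Y: "indep_vars (\<lambda>_. borel) Y I" for I
    unfolding Y_def
    by (rule indep_vars_compose2[OF indep_vars_subset[OF indep]]) auto
  have EY: "expectation (Y i) = c" for i
  proof -
    have "expectation (Y i) = expectation (indicator (X i -` A \<inter> space M))"
      by (intro Bochner_Integration.integral_cong) (auto simp: Y_def indicator_def)
    also have "\<dots> = c" using prob_A[of i] by simp
    finally show ?thesis .
  qed
  have card_eq: "real (card {i. i < n \<and> X i \<omega> \<in> A}) = (\<Sum>i<n. Y i \<omega>)" for n \<omega>
  proof -
    have "(\<Sum>i<n. Y i \<omega>) = (\<Sum>i\<in>{i. i < n \<and> X i \<omega> \<in> A}. 1)"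
      unfolding Y_def indicator_def by (rule sum.mono_neutral_cong_right) auto
    then show ?thesis by simp
  qed
  have AE_eps: "AE \<omega> in M. \<forall>\<^sub>F n in sequentially. \<bar>(\<Sum>i<n. Y i \<omega>) - real n * c\<bar> < real n * \<epsilon>"
    if \<epsilon>: "0 < \<epsilon>" for \<epsilon>
  proof -
    define B where "B n = {\<omega> \<in> space M. \<bar>(\<Sum>i<n. Y i \<omega>) - real n * c\<bar> \<ge> real n * \<epsilon>}" for n
    have B[measurable]: "B n \<in> events" for n
      unfolding B_def by measurable
    have bound: "prob (B n) \<le> 2 * exp (- 2 * \<epsilon>\<^sup>2) ^ n" for n
    proof (cases "n = 0")
      case False
      interpret Hoeffding_ineq M "{..<n}" Y "\<lambda>_. 0" "\<lambda>_. 1" "real n * c"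
        by unfold_locales (auto simp: indep_Y EY Y_def)
      have "prob (B n) \<le> 2 * exp (- 2 * (real n * \<epsilon>)\<^sup>2 / real n)"
        using Hoeffding_ineq_abs_ge[of "real n * \<epsilon>"] \<epsilon> False by (simp add: B_def)
      also have "- 2 * (real n * \<epsilon>)\<^sup>2 / real n = real n * (- 2 * \<epsilon>\<^sup>2)"
        using False by (simp add: power2_eq_square)
      finally show ?thesis
        by (simp only: exp_of_nat_mult)
    next
      case True
      have "prob (B n) \<le> 1" by simp
      then show ?thesis using True by (simp del: prob_le_1)
    qed
    have "summable (\<lambda>n. 2 * exp (- 2 * \<epsilon>\<^sup>2) ^ n)"
      using \<epsilon> by (intro summable_mult summable_geometric) auto
    then have "summable (\<lambda>n. prob (B n))"
      by (rule summable_comparison_test_ev[rotated]) (use bound in auto)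
    then have "AE \<omega> in M. \<forall>\<^sub>F n in sequentially. \<omega> \<in> space M - B n"
      by (intro borel_cantelli_AE1) (auto simp: emeasure_eq_measure)
    then show ?thesis
      by eventually_elim (auto simp: B_def not_le elim: eventually_mono)
  qed
  have "AE \<omega> in M. \<forall>m. \<forall>\<^sub>F n in sequentially. \<bar>(\<Sum>i<n. Y i \<omega>) - real n * c\<bar> < real n * (1 / real (Suc m))"
    unfolding AE_all_countable by (intro allI AE_eps) simp
  then show ?thesis
  proof eventually_elim
    case (elim \<omega>)
    show ?case
    proof (rule LIMSEQ_I)
      fix r :: real assume "0 < r"
      then obtain m where m: "1 / real (Suc m) < r"
        using nat_approx_posE by blast
      have "\<forall>\<^sub>F n in sequentially. norm ((\<Sum>i<n. Y i \<omega>) / real n - c) < r"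
        using elim[rule_format, of m] eventually_gt_at_top[of 0]
      proof eventually_elim
        case (elim n)
        have "(\<Sum>i<n. Y i \<omega>) / real n - c = ((\<Sum>i<n. Y i \<omega>) - real n * c) / real n"
          using elim(2) by (simp add: field_simps)
        then have "\<bar>(\<Sum>i<n. Y i \<omega>) / real n - c\<bar> = \<bar>(\<Sum>i<n. Y i \<omega>) - real n * c\<bar> / real n"
          by (simp add: abs_divide)
        also have "\<dots> < 1 / real (Suc m)"
          using elim by (simp add: divide_less_eq mult.commute)
        finally show ?case using m by simp
      qed
      then show "\<exists>no. \<forall>n\<ge>no. norm (real (card {i. i < n \<and> X i \<omega> \<in> A}) / real n - c) < r"
        by (simp add: eventually_sequentially card_eq)
    qed
  qed
qed

lemma (in prob_space) distributed_prob_eq_set_integral: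
  fixes Z :: "'a \<Rightarrow> real" and f :: "real \<Rightarrow> real"
  assumes Z: "distributed M lborel Z (\<lambda>x. ennreal (indicator {0<..} x * f x))"
    and f: "\<And>x. 0 < x \<Longrightarrow> 0 \<le> f x" "set_integrable lborel {0<..} f"
    and A: "A \<in> sets borel"
  shows "prob (Z -` A \<inter> space M) = (LINT x:{0<..} \<inter> A|lborel. f x)"
proof -
  have "emeasure M (Z -` A \<inter> space M) = (\<integral>\<^sup>+x. ennreal (indicator {0<..} x * f x) * indicator A x \<partial>lborel)"
    using A by (intro distributed_emeasure[OF Z]) auto
  also have "\<dots> = (\<integral>\<^sup>+x. ennreal (indicator ({0<..} \<inter> A) x *\<^sub>R f x) \<partial>lborel)"
    by (intro nn_integral_cong) (auto simp: indicator_def)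
  also have "\<dots> = ennreal (LINT x:{0<..} \<inter> A|lborel. f x)"
    unfolding set_lebesgue_integral_def
    using set_integrable_subset[OF f(2), of "{0<..} \<inter> A"] A f(1)
    by (intro nn_integral_eq_integral) (auto simp: set_integrable_def indicator_def)
  finally have "ennreal (prob (Z -` A \<inter> space M)) = ennreal (LINT x:{0<..} \<inter> A|lborel. f x)"
    by (simp add: emeasure_eq_measure)
  moreover have "0 \<le> (LINT x:{0<..} \<inter> A|lborel. f x)"
    unfolding set_lebesgue_integral_def using f(1) by (intro integral_nonneg_AE) (auto simp: indicator_def)
  ultimately show ?thesis by simp
qed

text \<open>
  Almost surely the true density is positive at every observation, so its log-likelihood is finite and
  a maximizer has to be positive at the observations too.
\<close>

lemma distributed_AE_pos:
  fixes Z :: "'a \<Rightarrow> real" and f :: "real \<Rightarrow> real"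
  assumes Z: "distributed M lborel Z (\<lambda>x. ennreal (indicator {0<..} x * f x))"
  shows "AE \<omega> in M. 0 < Z \<omega> \<and> 0 < f (Z \<omega>)"
proof -
  have meas[measurable]: "(\<lambda>x. ennreal (indicator {0<..} x * f x)) \<in> borel_measurable borel"
    using Z by (auto simp: distributed_def)
  define S where "S = {x. 0 < ennreal (indicator {0<..} x * f x)}"
  have S: "S \<in> sets lborel" unfolding S_def by measurable
  have "AE x in density lborel (\<lambda>x. ennreal (indicator {0<..} x * f x)). x \<in> S"
    by (subst AE_density) (auto simp: S_def)
  then have "AE x in distr M lborel Z. x \<in> S"
    unfolding distributed_distr_eq_density[OF Z] .
  then have "AE \<omega> in M. Z \<omega> \<in> S"
    using Z S by (subst (asm) AE_distr_iff) (auto simp: distributed_def)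
  then show ?thesis
    by eventually_elim (auto simp: S_def indicator_def of_bool_def split: if_splits)
qed

section \<open>Mellin transforms and the mixing distribution\<close>

text \<open>
  The mixture is a scale mixture: \<open>x\<close> is distributed as a product of \<open>t\<close> and an independent variable
  with density \<open>mixing_kernel k u 1\<close>, which is a beta density for finite \<open>k\<close> and exponential for
  \<open>k = \<infinity>\<close>.
\<close>

lemma mixing_kernel_scale:
  assumes "1 \<le> k" "0 < t"
  shows "mixing_kernel k x t = mixing_kernel k (x / t) 1 / t"
proof (cases k)
  case (enat m)
  then obtain n where m: "m = Suc n"
    using assms(1) by (cases m) (auto simp: one_enat_def)
  have "(t - x) ^ n = t ^ n * (1 - x / t) ^ n"
    using assms(2) by (simp add: right_diff_distrib flip: power_mult_distrib)
  then show ?thesis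
    using assms(2) enat by (simp add: mixing_kernel_def m divide_le_eq)
qed (simp add: mixing_kernel_def)

lemma mixing_kernel_nonneg: "0 < t \<Longrightarrow> 0 \<le> mixing_kernel k x t"
  by (auto simp: mixing_kernel_def split: enat.split)

lemma measurable_mixing_kernel[measurable]:
  assumes [measurable]: "f \<in> borel_measurable M" "g \<in> borel_measurable M"
  shows "(\<lambda>x. mixing_kernel k (f x) (g x)) \<in> borel_measurable M"
  by (cases k) (simp_all add: mixing_kernel_def)

text \<open>
  The Mellin transform of the unscaled kernel on the vertical line through \<open>1\<close>, or equivalently the
  characteristic function of the logarithm of the scale factor.
\<close>

definition mellin_kernel :: "enat \<Rightarrow> real \<Rightarrow> complex" where
  "mellin_kernel k \<xi> = (CLINT u:{0<..}|lborel. complex_of_real (mixing_kernel k u 1) * iexp (\<xi> * ln u))"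

lemma set_integrable_mult_iexp:
  assumes "set_integrable lborel S f"
  shows "set_integrable lborel S (\<lambda>u. complex_of_real (f u) * iexp (\<xi> * ln u))"
proof -
  have [measurable]: "(\<lambda>u. indicator S u *\<^sub>R f u) \<in> borel_measurable borel"
    using assms borel_measurable_integrable unfolding set_integrable_def by force
  have "(\<lambda>u. complex_of_real (indicator S u *\<^sub>R f u) * iexp (\<xi> * ln u)) \<in> borel_measurable borel"
    by measurable
  moreover have "indicator S u *\<^sub>R (complex_of_real (f u) * iexp (\<xi> * ln u)) =
      complex_of_real (indicator S u *\<^sub>R f u) * iexp (\<xi> * ln u)" for u
    by (simp add: indicator_def)
  ultimately have "(\<lambda>u. indicator S u *\<^sub>R (complex_of_real (f u) * iexp (\<xi> * ln u))) \<in> borel_measurable lborel"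
    by simp
  then show ?thesis
    unfolding set_integrable_def
    by (rule Bochner_Integration.integrable_bound[OF assms[unfolded set_integrable_def]])
      (auto simp: norm_mult)
qed

text \<open>
  A complex beta integral, by induction on \<open>n\<close>: the factor \<open>1 - u\<close> splits the integral into the
  ones at \<open>z\<close> and \<open>z + 1\<close>.
\<close>

lemma has_integral_powr_mult_power:
  assumes "0 < Re z"
  shows "((\<lambda>u. complex_of_real u powr (z - 1) * (1 - complex_of_real u) ^ n) has_integral
    (fact n / pochhammer z (Suc n))) {0..1}"
  using assms
proof (induction n arbitrary: z)
  case 0
  then have "((\<lambda>u. complex_of_real u powr (z - 1)) has_integral
      (of_real 1 powr z / z - of_real 0 powr z / z)) {0..1}"
    by (intro fundamental_theorem_of_calculus_interior)
       (auto intro!: continuous_intros derivative_eq_intros has_vector_derivative_real_field)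
  then show ?case by simp
next
  case (Suc n)
  have nz: "z + of_nat j \<noteq> 0" for j
    using Suc.prems by (auto simp: complex_eq_iff)
  have diff: "((\<lambda>u. complex_of_real u powr (z - 1) * (1 - complex_of_real u) ^ n
      - complex_of_real u powr (z + 1 - 1) * (1 - complex_of_real u) ^ n) has_integral
      (fact n / pochhammer z (Suc n) - fact n / pochhammer (z + 1) (Suc n))) {0..1}"
    using Suc by (intro has_integral_diff Suc.IH) auto
  have integrand: "complex_of_real u powr (z - 1) * (1 - complex_of_real u) ^ n
      - complex_of_real u powr (z + 1 - 1) * (1 - complex_of_real u) ^ n
      = complex_of_real u powr (z - 1) * (1 - complex_of_real u) ^ Suc n" if "u \<in> {0..1}" for u :: real
  proof (cases "u = 0")
    case False
    then have "complex_of_real u powr (z + 1 - 1) = complex_of_real u powr (z - 1) * complex_of_real u"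
      using powr_add[of "complex_of_real u" "z - 1" 1] by simp
    then show ?thesis by (simp add: algebra_simps)
  qed (use nz[of 0] in simp)
  have "fact n / pochhammer z (Suc n) - fact n / pochhammer (z + 1) (Suc n)
      = (fact (Suc n) / pochhammer z (Suc (Suc n)) :: complex)"
  proof -
    define P where "P = pochhammer (z + 1) n"
    define w where "w = z + of_nat (Suc n)"
    have "P \<noteq> 0"
    proof
      assume "P = 0"
      then obtain j where "z + 1 = - of_nat j" by (auto simp: P_def pochhammer_eq_0_iff)
      then show False using nz[of "Suc j"] by (simp add: add.assoc[symmetric])
    qed
    have w: "w \<noteq> 0" "w - z = of_nat (Suc n)"
      using nz[of "Suc n"] by (auto simp: w_def simp del: of_nat_Suc)
    have "pochhammer z (Suc n) = z * P"
      by (simp add: P_def pochhammer_rec)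
    moreover have "pochhammer (z + 1) (Suc n) = P * w"
      by (simp add: P_def w_def pochhammer_Suc add_ac)
    moreover have "pochhammer z (Suc (Suc n)) = z * (P * w)"
      using pochhammer_rec[of z "Suc n"] \<open>pochhammer (z + 1) (Suc n) = P * w\<close> by simp
    moreover have "fact n / (z * P) - fact n / (P * w) = fact n * (w - z) / (z * (P * w))"
      using \<open>P \<noteq> 0\<close> w(1) nz[of 0] by (simp add: field_simps)
    ultimately show ?thesis
      by (simp only: w(2) fact_Suc) (simp add: mult.commute)
  qed
  then show ?case
    using has_integral_eq[OF integrand diff] by simp
qed

lemma powr_i_eq_iexp:
  assumes "0 < u"
  shows "complex_of_real u powr (\<i> * complex_of_real \<xi>) = iexp (\<xi> * ln u)"
  using assms by (simp add: powr_def Ln_of_real mult.assoc)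

text \<open>
  Non-vanishing of the transform makes the mixing distribution identifiable. The value is
  \<open>k! / \<Prod>j=1..k. (j + \<i> \<xi>)\<close> for finite \<open>k\<close> and \<open>\<Gamma>(1 + \<i> \<xi>)\<close> for \<open>k = \<infinity>\<close>.
\<close>

lemma mixing_kernel_integrable_mellin_nonzero:
  assumes "1 \<le> k"
  shows "set_integrable lborel {0<..} (\<lambda>u. mixing_kernel k u 1)" "mellin_kernel k \<xi> \<noteq> 0"
proof -
  define z where "z = 1 + \<i> * complex_of_real \<xi>"
  have z: "0 < Re z" by (simp add: z_def)
  have "set_integrable lborel {0<..} (\<lambda>u. mixing_kernel k u 1) \<and> mellin_kernel k \<xi> \<noteq> 0"
  proof (cases k)
    case (enat m)
    then obtain n where m: "m = Suc n"
      using assms(1) by (cases m) (auto simp: one_enat_def)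
    have "set_integrable lborel {0<..1} (\<lambda>u. real m * (1 - u) ^ n)"
      by (rule set_integrable_subset[of _ "{0..1}"])
        (auto intro!: borel_integrable_atLeastAtMost' continuous_intros)
    moreover have "(\<lambda>u. indicator {0<..} u *\<^sub>R mixing_kernel k u 1)
        = (\<lambda>u. indicator {0<..1} u *\<^sub>R (real m * (1 - u) ^ n))"
      by (auto simp: mixing_kernel_def enat m indicator_def)
    ultimately have int: "set_integrable lborel {0<..} (\<lambda>u. mixing_kernel k u 1)"
      unfolding set_integrable_def by simp
    have "((\<lambda>u. of_nat m * (complex_of_real u powr (z - 1) * (1 - complex_of_real u) ^ n)) has_integral
        (of_nat m * (fact n / pochhammer z (Suc n)))) {0..1}"
      by (intro has_integral_mult_right has_integral_powr_mult_power z)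
    then have "((\<lambda>u. if u \<in> {0..1} then of_nat m * (complex_of_real u powr (z - 1) * (1 - complex_of_real u) ^ n) else 0)
        has_integral (of_nat m * (fact n / pochhammer z (Suc n)))) UNIV"
      by (simp only: has_integral_restrict_UNIV)
    then have "((\<lambda>u. if u \<in> {0<..} then complex_of_real (mixing_kernel k u 1) * iexp (\<xi> * ln u) else 0)
        has_integral (of_nat m * (fact n / pochhammer z (Suc n)))) UNIV"
      by (rule has_integral_spike[of "{0}", rotated 2])
        (auto simp: mixing_kernel_def enat m z_def powr_i_eq_iexp)
    then have "((\<lambda>u. complex_of_real (mixing_kernel k u 1) * iexp (\<xi> * ln u)) has_integral
        (of_nat m * (fact n / pochhammer z (Suc n)))) {0<..}"
      by (simp only: has_integral_restrict_UNIV)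
    then have "mellin_kernel k \<xi> = of_nat m * (fact n / pochhammer z (Suc n))"
      unfolding mellin_kernel_def
      using set_borel_integral_eq_integral(2)[OF set_integrable_mult_iexp[OF int]] by (simp add: integral_unique)
    moreover have "pochhammer z (Suc n) \<noteq> 0"
    proof
      assume "pochhammer z (Suc n) = 0"
      then obtain j where "z = - of_nat j" by (auto simp: pochhammer_eq_0_iff)
      then show False using z by simp
    qed
    moreover have "complex_of_nat m \<noteq> 0"
      unfolding of_nat_eq_0_iff using m by simp
    ultimately show ?thesis using int by simp
  next
    case infinity
    have "(\<lambda>u. complex_of_real u powr (1 - 1) / of_real (exp u)) absolutely_integrable_on {0<..}"
      using absolutely_integrable_Gamma_integral'[of 1] by simp
    then have "integrable lebesgue (\<lambda>u. norm (indicator {0<..} u *\<^sub>R (complex_of_real u powr (1 - 1) / of_real (exp u))))"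
      unfolding set_integrable_def by (rule integrable_norm)
    moreover have "(\<lambda>u. norm (indicator {0<..} u *\<^sub>R (complex_of_real u powr (1 - 1) / of_real (exp u))))
        = (\<lambda>u. indicator {0<..} u *\<^sub>R mixing_kernel k u 1)"
      by (auto simp: mixing_kernel_def infinity indicator_def exp_minus norm_divide inverse_eq_divide)
    ultimately have "integrable lebesgue (\<lambda>u. indicator {0<..} u *\<^sub>R mixing_kernel k u 1)"
      by simp
    then have int: "set_integrable lborel {0<..} (\<lambda>u. mixing_kernel k u 1)"
      unfolding set_integrable_def by (subst (asm) integrable_completion) auto
    have eq: "complex_of_real u powr (z - 1) / of_real (exp u)
        = complex_of_real (mixing_kernel k u 1) * iexp (\<xi> * ln u)" if "u \<in> {0<..}" for u
    proof -
      define e where "e = iexp (\<xi> * ln u)"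
      have "complex_of_real u powr (z - 1) = e"
        using powr_i_eq_iexp[of u \<xi>] that unfolding e_def z_def by simp
      then show ?thesis
        unfolding e_def[symmetric] by (simp add: mixing_kernel_def infinity exp_minus field_simps)
    qed
    have "((\<lambda>u. complex_of_real (mixing_kernel k u 1) * iexp (\<xi> * ln u)) has_integral Gamma z) {0<..}"
      by (rule has_integral_eq[OF eq Gamma_integral_complex'[OF z]])
    then have "mellin_kernel k \<xi> = Gamma z"
      unfolding mellin_kernel_def
      using set_borel_integral_eq_integral(2)[OF set_integrable_mult_iexp[OF int]] by (simp add: integral_unique)
    moreover have "Gamma z \<noteq> 0"
      using z by (auto simp: Gamma_eq_zero_iff elim!: nonpos_Ints_cases)
    ultimately show ?thesis using int by simp
  qed
  then show "set_integrable lborel {0<..} (\<lambda>u. mixing_kernel k u 1)" "mellin_kernel k \<xi> \<noteq> 0" by auto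
qed

lemma pos_distribution_function_measure:
  assumes F: "pos_distribution_function F"
  shows "real_distribution (interval_measure F)" "cdf (interval_measure F) = F"
    and "AE t in interval_measure F. 0 < t"
proof -
  have mono: "\<And>x y. x \<le> y \<Longrightarrow> F x \<le> F y" and rc: "\<And>a. continuous (at_right a) F"
    and top: "(F \<longlongrightarrow> 1) at_top" and neg: "\<And>x. x \<le> 0 \<Longrightarrow> F x = 0"
    using F by (auto simp: pos_distribution_function_def mono_def)
  have bot: "(F \<longlongrightarrow> 0) at_bot"
    by (rule tendsto_eventually, rule eventually_mono[OF eventually_le_at_bot[of 0]]) (rule neg)
  show real_dist: "real_distribution (interval_measure F)"
    by (rule real_distribution_interval_measure[OF mono rc bot top])
  show cdf: "cdf (interval_measure F) = F"
    by (rule cdf_interval_measure[OF mono rc bot])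
  interpret real_distribution "interval_measure F" by (rule real_dist)
  have "measure (interval_measure F) {..0} = 0"
    using cdf neg[of 0] by (simp add: cdf_def fun_eq_iff)
  then have "emeasure (interval_measure F) {..0} = 0"
    by (simp add: emeasure_eq_measure)
  then show "AE t in interval_measure F. 0 < t"
    by (intro AE_I[of _ _ "{..0}"]) auto
qed

text \<open>
  Mellin transforms turn the scale mixture into a product: exchange the two integrals and substitute
  \<open>x = t u\<close>.
\<close>

lemma mellin_mixture:
  assumes k: "1 \<le> k" and F: "pos_distribution_function F"
  shows "(CLINT x:{0<..}|lborel. complex_of_real (LINT t:{0<..}|interval_measure F. mixing_kernel k x t) * iexp (\<xi> * ln x))
    = mellin_kernel k \<xi> * (CLINT t|interval_measure F. iexp (\<xi> * ln t))"
proof -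
  let ?N = "interval_measure F"
  interpret N: real_distribution ?N
    by (rule pos_distribution_function_measure(1)[OF F])
  interpret pair_sigma_finite ?N "lborel :: real measure"
    by unfold_locales
  define f where "f t x = indicator {0<..} t *\<^sub>R indicator {0<..} x *\<^sub>R
    (complex_of_real (mixing_kernel k x t) * iexp (\<xi> * ln x))" for t x :: real
  define C where "C = (LINT u:{0<..}|lborel. mixing_kernel k u 1)"
  have \<kappa>: "set_integrable lborel {0<..} (\<lambda>u. mixing_kernel k u 1)"
    by (rule mixing_kernel_integrable_mellin_nonzero(1)[OF k])
  have scaled: "f t (0 + t * u) = (indicator {0<..} u *\<^sub>R (complex_of_real (mixing_kernel k u 1) * iexp (\<xi> * ln u)))
      * (iexp (\<xi> * ln t) / complex_of_real t)" if "0 < t" for t u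
  proof (cases "0 < u")
    case True
    then show ?thesis
      using that mixing_kernel_scale[OF k that, of "t * u"]
      by (simp add: f_def ln_mult_pos distrib_left exp_add)
  qed (use that in \<open>auto simp: f_def zero_less_mult_iff\<close>)
  have int_scaled: "integrable lborel (\<lambda>u. f t (0 + t * u))" if "0 < t" for t
    unfolding scaled[OF that] using set_integrable_mult_iexp[OF \<kappa>, of \<xi>]
    by (intro integrable_mult_left) (auto simp: set_integrable_def)
  have int_f: "integrable lborel (f t)" for t
  proof (cases "0 < t")
    case True
    then show ?thesis
      using lborel_integrable_real_affine_iff[of t "f t" 0] int_scaled[OF True] by simp
  qed (auto simp: f_def[abs_def])
  have inner: "(CLINT x|lborel. f t x) = mellin_kernel k \<xi> * iexp (\<xi> * ln t)" if "0 < t" for t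
  proof -
    have "(CLINT x|lborel. f t x) = \<bar>t\<bar> *\<^sub>R (CLINT u|lborel. f t (0 + t * u))"
      using that by (intro lborel_integral_real_affine) auto
    also have "\<dots> = t *\<^sub>R (mellin_kernel k \<xi> * (iexp (\<xi> * ln t) / complex_of_real t))"
      using that unfolding scaled[OF that] mellin_kernel_def set_lebesgue_integral_def
      by (simp only: integral_mult_left_zero abs_of_pos)
    finally show ?thesis using that by (simp add: scaleR_conv_of_real)
  qed
  have norm_inner: "(LINT x|lborel. norm (f t x)) = C" if "0 < t" for t
  proof -
    have "(LINT x|lborel. norm (f t x)) = \<bar>t\<bar> *\<^sub>R (LINT u|lborel. norm (f t (0 + t * u)))"
      using that by (intro lborel_integral_real_affine) auto
    also have "(\<lambda>u. norm (f t (0 + t * u))) = (\<lambda>u. (indicator {0<..} u *\<^sub>R mixing_kernel k u 1) / t)"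
      unfolding scaled[OF that] using that mixing_kernel_nonneg[of 1 k]
      by (auto simp: norm_mult norm_divide fun_eq_iff indicator_def)
    finally show ?thesis
      using that by (simp add: C_def set_lebesgue_integral_def)
  qed
  have meas: "case_prod f \<in> borel_measurable (?N \<Otimes>\<^sub>M lborel)"
    unfolding f_def[abs_def] by measurable
  have int: "integrable (?N \<Otimes>\<^sub>M lborel) (case_prod f)"
  proof (rule Fubini_integrable[OF meas])
    have "integrable ?N (\<lambda>t. indicator {0<..} t *\<^sub>R C)"
      by (intro N.integrable_const_bound[of _ "\<bar>C\<bar>"]) (auto simp: indicator_def)
    also have "(\<lambda>t. indicator {0<..} t *\<^sub>R C) = (\<lambda>t. LINT x|lborel. norm (case_prod f (t, x)))"
    proof
      fix t :: real
      show "indicator {0<..} t *\<^sub>R C = (LINT x|lborel. norm (case_prod f (t, x)))"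
        using norm_inner[of t] by (cases "0 < t") (auto simp: f_def)
    qed
    finally show "integrable ?N (\<lambda>t. LINT x|lborel. norm (case_prod f (t, x)))" .
  qed (use int_f in simp)
  have "(CLINT x:{0<..}|lborel. complex_of_real (LINT t:{0<..}|?N. mixing_kernel k x t) * iexp (\<xi> * ln x))
     = (CLINT x|lborel. CLINT t|?N. f t x)"
    unfolding set_lebesgue_integral_def
  proof (intro Bochner_Integration.integral_cong refl)
    fix x :: real
    have "(CLINT t|?N. f t x) = (CLINT t|?N. complex_of_real (indicator {0<..} t *\<^sub>R mixing_kernel k x t)
        * (indicator {0<..} x *\<^sub>R iexp (\<xi> * ln x)))"
      by (intro Bochner_Integration.integral_cong) (auto simp: f_def indicator_def)
    also have "\<dots> = complex_of_real (LINT t|?N. indicator {0<..} t *\<^sub>R mixing_kernel k x t)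
        * (indicator {0<..} x *\<^sub>R iexp (\<xi> * ln x))"
      by (simp only: integral_mult_left_zero integral_complex_of_real)
    finally show "indicator {0<..} x *\<^sub>R (complex_of_real (LINT t|?N. indicator {0<..} t *\<^sub>R mixing_kernel k x t) * iexp (\<xi> * ln x))
        = (CLINT t|?N. f t x)"
      by simp
  qed
  also have "\<dots> = (CLINT t|?N. CLINT x|lborel. f t x)"
    using Fubini_integral[OF int] by simp
  also have "\<dots> = (CLINT t|?N. mellin_kernel k \<xi> * iexp (\<xi> * ln t))"
  proof (rule integral_cong_AE)
    show "AE t in ?N. (CLINT x|lborel. f t x) = mellin_kernel k \<xi> * iexp (\<xi> * ln t)"
      using pos_distribution_function_measure(3)[OF F] by eventually_elim (rule inner)
    show "(\<lambda>t. CLINT x|lborel. f t x) \<in> borel_measurable ?N"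
      using meas by (intro lborel.borel_measurable_lebesgue_integral) simp
  qed measurable
  finally show ?thesis by simp
qed

lemma mellin_density_eq_char:
  assumes k: "1 \<le> k" and g: "set_integrable lborel {0<..} g" and F: "is_mixing_df k g F"
  shows "(CLINT x:{0<..}|lborel. complex_of_real (g x) * iexp (\<xi> * ln x))
    = mellin_kernel k \<xi> * char (distr (interval_measure F) borel ln) \<xi>"
proof -
  let ?N = "interval_measure F"
  have pos: "pos_distribution_function F"
    and eq: "AE x in lborel. 0 < x \<longrightarrow> g x = (LINT t:{0<..}|?N. mixing_kernel k x t)"
    using F by (auto simp: is_mixing_df_def)
  interpret N: real_distribution ?N
    by (rule pos_distribution_function_measure(1)[OF pos])
  have "(CLINT x:{0<..}|lborel. complex_of_real (g x) * iexp (\<xi> * ln x)) =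
     (CLINT x:{0<..}|lborel. complex_of_real (LINT t:{0<..}|?N. mixing_kernel k x t) * iexp (\<xi> * ln x))"
    unfolding set_lebesgue_integral_def
  proof (rule integral_cong_AE)
    show "(\<lambda>x. indicator {0<..} x *\<^sub>R (complex_of_real (g x) * iexp (\<xi> * ln x))) \<in> borel_measurable lborel"
      using set_integrable_mult_iexp[OF g, of \<xi>] by (auto simp: set_integrable_def)
    show "AE x in lborel. indicator {0<..} x *\<^sub>R (complex_of_real (g x) * iexp (\<xi> * ln x)) =
      indicator {0<..} x *\<^sub>R (complex_of_real (LINT t|?N. indicator {0<..} t *\<^sub>R mixing_kernel k x t) * iexp (\<xi> * ln x))"
      using eq by eventually_elim (auto simp: indicator_def set_lebesgue_integral_def)
  qed measurable
  then show ?thesis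
    unfolding mellin_mixture[OF k pos] by (simp add: char_def integral_distr)
qed

lemma cdf_distr_ln:
  assumes F: "pos_distribution_function F"
  shows "real_distribution (distr (interval_measure F) borel ln)"
    and "cdf (distr (interval_measure F) borel ln) y = F (exp y)"
proof -
  let ?N = "interval_measure F"
  interpret N: real_distribution ?N
    by (rule pos_distribution_function_measure(1)[OF F])
  show "real_distribution (distr ?N borel ln)"
    by (intro N.real_distribution_distr) simp
  have "cdf (distr ?N borel ln) y = measure ?N (ln -` {..y} \<inter> space ?N)"
    unfolding cdf_def by (subst measure_distr) auto
  also have "\<dots> = measure ?N {..exp y}"
  proof (rule N.finite_measure_eq_AE)
    show "AE t in ?N. t \<in> ln -` {..y} \<inter> space ?N \<longleftrightarrow> t \<in> {..exp y}"
      using pos_distribution_function_measure(3)[OF F]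
      by eventually_elim (auto, metis exp_le_cancel_iff exp_ln, metis exp_le_cancel_iff exp_ln)
  qed (use measurable_sets[of ln borel borel "{..y}"] in simp_all)
  also have "\<dots> = F (exp y)"
    using pos_distribution_function_measure(2)[OF F] by (simp add: cdf_def fun_eq_iff)
  finally show "cdf (distr ?N borel ln) y = F (exp y)" .
qed

text \<open>
  Divide the Mellin transforms of the densities, which converge because the densities converge in
  \<open>L\<^sup>1\<close>, by the nonzero transform of the kernel: the characteristic functions of the logarithms of the
  mixing variables converge, and the continuity theorem of Levy applies. It yields tightness as well, so
  no mass can escape to \<open>0\<close> or \<open>\<infinity>\<close>. The hypotheses start at index \<open>1\<close>, hence the shift by \<open>Suc\<close>.
\<close>

lemma weak_conv_mixing_df:
  fixes g :: "nat \<Rightarrow> real \<Rightarrow> real"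
  assumes k: "1 \<le> k"
    and g: "\<And>n. 1 \<le> n \<Longrightarrow> set_integrable lborel {0<..} (g n)" "set_integrable lborel {0<..} g0"
    and conv: "(\<lambda>n. LINT x:{0<..}|lborel. \<bar>g n x - g0 x\<bar>) \<longlonglongrightarrow> 0"
    and F: "\<And>n. 1 \<le> n \<Longrightarrow> is_mixing_df k (g n) (F n)" "is_mixing_df k g0 F0"
  shows "weak_conv F F0"
proof -
  define L where "L F = distr (interval_measure F) borel ln" for F :: "real \<Rightarrow> real"
  have pos: "pos_distribution_function F0" "\<And>n. 1 \<le> n \<Longrightarrow> pos_distribution_function (F n)"
    using F by (auto simp: is_mixing_df_def)
  have "(\<lambda>n. char (L (F (Suc n))) \<xi>) \<longlonglongrightarrow> char (L F0) \<xi>" for \<xi>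
  proof -
    define m where "m = mellin_kernel k \<xi>"
    have m: "m \<noteq> 0"
      unfolding m_def by (rule mixing_kernel_integrable_mellin_nonzero(2)[OF k])
    have bound: "norm (m * char (L (F n)) \<xi> - m * char (L F0) \<xi>) \<le> (LINT x:{0<..}|lborel. \<bar>g n x - g0 x\<bar>)"
      if n: "1 \<le> n" for n
    proof -
      have "m * char (L (F n)) \<xi> - m * char (L F0) \<xi> =
          (CLINT x:{0<..}|lborel. complex_of_real (g n x) * iexp (\<xi> * ln x) - complex_of_real (g0 x) * iexp (\<xi> * ln x))"
        unfolding L_def m_def mellin_density_eq_char[OF k g(1)[OF n] F(1)[OF n], symmetric]
          mellin_density_eq_char[OF k g(2) F(2), symmetric]
        by (rule set_integral_diff(2)[symmetric]; rule set_integrable_mult_iexp) (rule g n)+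
      also have "norm \<dots> \<le> (LINT x|lborel. norm (indicator {0<..} x *\<^sub>R
          (complex_of_real (g n x) * iexp (\<xi> * ln x) - complex_of_real (g0 x) * iexp (\<xi> * ln x))))"
        unfolding set_lebesgue_integral_def by (rule integral_norm_bound)
      also have "\<dots> = (LINT x:{0<..}|lborel. \<bar>g n x - g0 x\<bar>)"
        unfolding set_lebesgue_integral_def
      proof (intro Bochner_Integration.integral_cong refl)
        fix x :: real
        define e where "e = iexp (\<xi> * ln x)"
        have "norm e = 1" by (simp add: e_def)
        then show "norm (indicator {0<..} x *\<^sub>R (complex_of_real (g n x) * iexp (\<xi> * ln x) - complex_of_real (g0 x) * iexp (\<xi> * ln x)))
            = indicator {0<..} x *\<^sub>R \<bar>g n x - g0 x\<bar>"
          unfolding e_def[symmetric] left_diff_distrib[symmetric] of_real_diff[symmetric]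
          by (simp add: norm_mult del: of_real_diff)
      qed
      finally show ?thesis .
    qed
    have "(\<lambda>n. m * char (L (F (Suc n))) \<xi> - m * char (L F0) \<xi>) \<longlonglongrightarrow> 0"
      by (rule Lim_null_comparison[OF _ LIMSEQ_Suc[OF conv]]) (use bound in auto)
    then have "(\<lambda>n. m * char (L (F (Suc n))) \<xi>) \<longlonglongrightarrow> m * char (L F0) \<xi>"
      by (simp add: LIM_zero_iff)
    then show ?thesis
      using m by (simp add: tendsto_mult_left_iff)
  qed
  then have weak_conv: "weak_conv_m (\<lambda>n. L (F (Suc n))) (L F0)"
    using pos by (intro levy_continuity) (auto simp: L_def cdf_distr_ln)
  have *: "(\<lambda>n. F (Suc n) (exp y)) \<longlonglongrightarrow> F0 (exp y)" if "isCont (\<lambda>y. F0 (exp y)) y" for y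
  proof -
    have "cdf (L G) = (\<lambda>y. G (exp y))" if "pos_distribution_function G" for G
      unfolding L_def using cdf_distr_ln(2)[OF that] by auto
    then show ?thesis
      using weak_conv that pos by (simp add: weak_conv_m_def weak_conv_def)
  qed
  show ?thesis
    unfolding weak_conv_def
  proof (intro allI impI)
    fix x assume x: "isCont F0 x"
    have "(\<lambda>n. F (Suc n) x) \<longlonglongrightarrow> F0 x"
    proof (cases "0 < x")
      case True
      have "isCont (\<lambda>y. F0 (exp y)) (ln x)"
        by (rule isCont_o2[of _ exp F0]) (use x True in auto)
      from *[OF this] show ?thesis using True by simp
    next
      case False
      then show ?thesis using pos by (simp add: pos_distribution_function_def)
    qed
    then show "(\<lambda>n. F n x) \<longlonglongrightarrow> F0 x" by (rule LIMSEQ_imp_Suc)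
  qed
qed

section \<open>Consistency\<close>

lemma hellinger_dist_le_L1:
  fixes p q :: "real \<Rightarrow> real"
  assumes p: "set_integrable lborel {0<..} p" "\<And>x. 0 < x \<Longrightarrow> 0 \<le> p x"
    and q: "set_integrable lborel {0<..} q" "\<And>x. 0 < x \<Longrightarrow> 0 \<le> q x"
  shows "hellinger_dist (restrict_space lborel {0<..}) p q \<le>
    sqrt (1 / 2 * (LINT x:{0<..}|lborel. \<bar>p x - q x\<bar>))"
proof -
  have le: "(sqrt u - sqrt v)\<^sup>2 \<le> \<bar>u - v\<bar>" if "0 \<le> u" "0 \<le> v" for u v :: real
  proof -
    have "(sqrt u - sqrt v)\<^sup>2 = \<bar>sqrt u - sqrt v\<bar> * \<bar>sqrt u - sqrt v\<bar>"
      by (simp add: power2_eq_square flip: abs_mult)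
    also have "\<dots> \<le> \<bar>sqrt u - sqrt v\<bar> * (sqrt u + sqrt v)"
      using that by (intro mult_left_mono) (auto simp: abs_le_iff)
    also have "\<dots> = \<bar>(sqrt u - sqrt v) * (sqrt u + sqrt v)\<bar>"
      using that by (simp add: abs_mult)
    also have "(sqrt u - sqrt v) * (sqrt u + sqrt v) = u - v"
      using that by (simp add: algebra_simps)
    finally show ?thesis .
  qed
  have "(LINT x|restrict_space lborel {0<..}. (sqrt (p x) - sqrt (q x))\<^sup>2)
      = (LINT x|lborel. indicator {0<..} x *\<^sub>R (sqrt (p x) - sqrt (q x))\<^sup>2)"
    by (subst integral_restrict_space) auto
  also have "\<dots> \<le> (LINT x:{0<..}|lborel. \<bar>p x - q x\<bar>)"
    unfolding set_lebesgue_integral_def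
  proof (rule integral_mono')
    show "integrable lborel (\<lambda>x. indicator {0<..} x *\<^sub>R \<bar>p x - q x\<bar>)"
      using set_integrable_abs[OF set_integral_diff(1)[OF p(1) q(1)]] by (simp add: set_integrable_def)
  qed (use le p(2) q(2) in \<open>auto simp: indicator_def\<close>)
  finally show ?thesis
    unfolding hellinger_dist_def by simp
qed

theorem proposition3p1:
  fixes M :: "'w measure"
    and k :: enat
    and X :: "nat \<Rightarrow> 'w \<Rightarrow> real"
    and g0 F0 :: "real \<Rightarrow> real"
    and g_hat :: "nat \<Rightarrow> 'w \<Rightarrow> real \<Rightarrow> real"
  assumes "prob_space M"
    and "1 \<le> k"
    and "g0 \<in> k_monotone_densities k"
    and "is_mixing_df k g0 F0"
    and "prob_space.indep_vars M (\<lambda>_. borel) X UNIV"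
    and "\<And>i. distributed M lborel (X i) (\<lambda>x. ennreal (indicator {0<..} x * g0 x))"
    and "AE \<omega> in M. \<forall>n\<ge>1. is_mle k n (\<lambda>i. X i \<omega>) (g_hat n \<omega>)"
  shows "(AE \<omega> in M.
            (\<lambda>n. hellinger_dist (restrict_space lborel {0<..}) (g_hat n \<omega>) g0) \<longlonglongrightarrow> 0) \<and>
         (\<forall>F_hat :: nat \<Rightarrow> 'w \<Rightarrow> real \<Rightarrow> real.
            (AE \<omega> in M. \<forall>n\<ge>1. is_mixing_df k (g_hat n \<omega>) (F_hat n \<omega>)) \<longrightarrow>
            (AE \<omega> in M. weak_conv (\<lambda>n. F_hat n \<omega>) F0))"
proof -
  interpret prob_space M by fact
  note k = \<open>1 \<le> k\<close> and g0 = \<open>g0 \<in> k_monotone_densities k\<close>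
  have mono: "h \<in> k_monotone_densities 1" if "h \<in> k_monotone_densities k" for h
    using k_monotone_densities_subset_monotone[OF k] that by blast
  have density: "set_integrable lborel {0<..} h" "\<And>x. 0 < x \<Longrightarrow> 0 \<le> h x"
    if "h \<in> k_monotone_densities k" for h
    using mono[OF that] by (auto simp: monotone_density_iff)
  have AE_pos: "AE \<omega> in M. \<forall>i. 0 < X i \<omega> \<and> 0 < g0 (X i \<omega>)"
    unfolding AE_all_countable by (intro allI distributed_AE_pos) fact
  have AE_freq: "AE \<omega> in M. \<forall>a j. (\<lambda>n. real (card {i. i < n \<and> X i \<omega> \<in> grid_cell (1 / real a ^ 2) j}) / real n)
      \<longlonglongrightarrow> (LINT y:{0<..} \<inter> grid_cell (1 / real a ^ 2) j|lborel. g0 y)"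
    unfolding AE_all_countable
  proof (intro allI AE_empirical_frequency)
    fix a j i
    show cell: "grid_cell (1 / real a ^ 2) j \<in> sets borel"
      by (simp add: grid_cell_def)
    show "prob (X i -` grid_cell (1 / real a ^ 2) j \<inter> space M)
        = (LINT y:{0<..} \<inter> grid_cell (1 / real a ^ 2) j|lborel. g0 y)"
      by (rule distributed_prob_eq_set_integral[OF assms(6) density(2,1)[OF g0] cell])
  qed fact
  have AE_L1: "AE \<omega> in M. (\<lambda>n. LINT x:{0<..}|lborel. \<bar>g_hat n \<omega> x - g0 x\<bar>) \<longlonglongrightarrow> 0"
    using AE_pos AE_freq assms(7)
  proof eventually_elim
    case (elim \<omega>)
    have mle: "is_mle k n (\<lambda>i. X i \<omega>) (g_hat n \<omega>)" if "1 \<le> n" for n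
      using elim(3) that by blast
    have ratio: "(\<Sum>i<n. g0 (X i \<omega>) / g_hat n \<omega> (X i \<omega>)) \<le> real n" if "1 \<le> n" for n
      using mle_mean_ratio(2)[OF mle[OF that] g0] elim(1) by auto
    have pos: "0 < g_hat n \<omega> (X i \<omega>)" if "i < n" for n i
      using mle_mean_ratio(1)[OF mle g0, of n i] elim(1) that by auto
    show ?case
      by (rule L1_convergence_from_mean_ratio[of g0 "\<lambda>n. g_hat n \<omega>" "\<lambda>i. X i \<omega>"])
        (use elim mle ratio pos mono g0 in \<open>auto simp: is_mle_def\<close>)
  qed
  have AE_density: "AE \<omega> in M. \<forall>n\<ge>1. g_hat n \<omega> \<in> k_monotone_densities k"
    using assms(7) by eventually_elim (auto simp: is_mle_def)
  have "AE \<omega> in M. (\<lambda>n. hellinger_dist (restrict_space lborel {0<..}) (g_hat n \<omega>) g0) \<longlonglongrightarrow> 0"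
    using AE_L1 AE_density
  proof eventually_elim
    case (elim \<omega>)
    let ?L1 = "\<lambda>n. LINT x:{0<..}|lborel. \<bar>g_hat n \<omega> x - g0 x\<bar>"
    have "(\<lambda>n. sqrt (1 / 2 * ?L1 n)) \<longlonglongrightarrow> sqrt (1 / 2 * 0)"
      by (intro tendsto_intros elim(1))
    then have lim: "(\<lambda>n. sqrt (1 / 2 * ?L1 n)) \<longlonglongrightarrow> 0"
      by simp
    have bound: "norm (hellinger_dist (restrict_space lborel {0<..}) (g_hat n \<omega>) g0) \<le> sqrt (1 / 2 * ?L1 n)"
      if "1 \<le> n" for n
    proof -
      have "0 \<le> hellinger_dist (restrict_space lborel {0<..}) (g_hat n \<omega>) g0"
        by (simp add: hellinger_dist_def)
      moreover have h: "g_hat n \<omega> \<in> k_monotone_densities k"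
        using elim(2) that by blast
      ultimately show ?thesis
        using hellinger_dist_le_L1[OF density[OF h] density[OF g0]] by simp
    qed
    show ?case
      by (rule Lim_null_comparison[OF _ lim])
        (use bound in \<open>auto simp: eventually_sequentially intro!: exI[of _ 1]\<close>)
  qed
  moreover have "AE \<omega> in M. weak_conv (\<lambda>n. F_hat n \<omega>) F0"
    if "AE \<omega> in M. \<forall>n\<ge>1. is_mixing_df k (g_hat n \<omega>) (F_hat n \<omega>)" for F_hat
    using AE_L1 AE_density that
  proof eventually_elim
    case (elim \<omega>)
    show ?case
      by (rule weak_conv_mixing_df[OF k _ density(1)[OF g0] elim(1) _ assms(4)])
        (use elim density(1) in auto)
  qed
  ultimately show ?thesis by blast
qed

end
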